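(* Let $a\geq b$ be positive integers and let $G=(A,B,E)$ be an $(a,b)$--biregular bipartite graph on $v(G)$ vertices, i.e. every vertex of $A$ has degree $a$ and every vertex of $B$ has degree $b$ (so $|A|\leq|B|$). Let $0\leq k\leq |A|$ be an integer, let $m_k(G)$ denote the number of matchings of size $k$, let $p=\frac{2k}{v(G)}$ and $q=\frac{a+b}{2b}p$, and let $$p_{\mu}={|A|\choose k}q^k(1-q)^{|A|-k}$$ be the probability that a Binomial$(|A|,q)$ random variable takes its mean value $k$. Then $$m_k(G)\geq p_{\mu}\exp\big(v(G)\cdot \mathcal{G}_{a,b}(p)\big).$$
   Context: Let $H(q)=-(q\ln q+(1-q)\ln(1-q))$ for $0\leq q\leq 1$, with $H(0)=H(1)=0$. For positive integers $a,b$ and $0\leq p\leq \min\left(\frac{2a}{a+b},\frac{2b}{a+b}\right)$, $$\mathcal{G}_{a,b}(p)=\frac{a}{a+b}H\left(\frac{a+b}{2a}p\right)+\frac{b}{a+b}H\left(\frac{a+b}{2b}p\right)+\frac{1}{2}p\ln(ab)-\frac{ab}{a+b}H\left(\frac{a+b}{2ab}p\right).$$ A matching of size $k$ is a set of $k$ pairwise vertex-disjoint edges. *)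

theory Defs
  imports Complex_Main
begin

definition Hent :: "real \<Rightarrow> real" where
  "Hent q = (if q = 0 \<or> q = 1 then 0 else - (q * ln q + (1 - q) * ln (1 - q)))"

definition Gfun :: "nat \<Rightarrow> nat \<Rightarrow> real \<Rightarrow> real" where
  "Gfun a b p =
     real a / (real a + real b) * Hent ((real a + real b) / (2 * real a) * p)
   + real b / (real a + real b) * Hent ((real a + real b) / (2 * real b) * p)
   + 1/2 * p * ln (real a * real b)
   - real a * real b / (real a + real b) * Hent ((real a + real b) / (2 * real a * real b) * p)"

text \<open>Bipartite graph with parts A, B and edge set E \<subseteq> A \<times> B (edge {x,y} encoded as (x,y), x \<in> A).\<close>
definition bipartite_graph :: "'v set \<Rightarrow> 'v set \<Rightarrow> ('v \<times> 'v) set \<Rightarrow> bool" where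
  "bipartite_graph A B E \<longleftrightarrow> finite A \<and> finite B \<and> A \<inter> B = {} \<and> E \<subseteq> A \<times> B"

definition biregular :: "nat \<Rightarrow> nat \<Rightarrow> 'v set \<Rightarrow> 'v set \<Rightarrow> ('v \<times> 'v) set \<Rightarrow> bool" where
  "biregular a b A B E \<longleftrightarrow>
     bipartite_graph A B E \<and>
     (\<forall>x\<in>A. card {y. (x, y) \<in> E} = a) \<and>
     (\<forall>y\<in>B. card {x. (x, y) \<in> E} = b)"

definition matchings :: "('v \<times> 'v) set \<Rightarrow> nat \<Rightarrow> ('v \<times> 'v) set set" where
  "matchings E k = {M. M \<subseteq> E \<and> card M = k \<and>
     (\<forall>e\<in>M. \<forall>e'\<in>M. e \<noteq> e' \<longrightarrow> fst e \<noteq> fst e' \<and> snd e \<noteq> snd e')}"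

end

theory Submission
  imports Defs "HOL-Computational_Algebra.Computational_Algebra"
begin

text \<open>
Gurvits' capacity method with real-rootedness. Each of the vertices \<open>u \<in> A\<close> may stay unmatched or choose
a neighbour \<open>j\<close>, which has weight \<open>x j\<close>; this gives the product over \<open>A\<close> of \<open>1 + (\<Sum>j \<sim> u. x j)\<close>.
Truncating this polynomial to degree one in each variable \<open>x j\<close> leaves the generating function of the
matchings. The intermediate polynomials do not vanish on the right half-plane (Heilmann and Lieb), so by
homogeneity they are real-rooted in each single variable. Hence a truncation in a variable of degree
\<open>b\<close> multiplies a bound \<open>f x \<ge> K * (\<Prod>j. x j powr \<theta>)\<close>, where \<open>\<theta> = k / |B|\<close>, by at least
\<open>exp (H \<theta> + \<theta> ln b - b H (\<theta> / b))\<close>. By the inequality of the means the bound holds at the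
start with \<open>K = exp (|A| H q) * a ^ k\<close>, where \<open>q = k / |A|\<close>. After all truncations \<open>x j = t\<close> gives
\<open>(\<Sum>i. m_i * t ^ i) \<ge> K' * t ^ k\<close> for all \<open>t > 0\<close>, and Newton's inequalities extract
\<open>m_k \<ge> p_mu * K'\<close> from it, where \<open>ln K'\<close> is exactly the exponent of the theorem.
\<close>

section \<open>Weighted sums over matchings\<close>

text \<open>
The sum over the matchings between \<open>U\<close> and the vertices of the list, where a matched vertex \<open>j\<close> of
the list contributes \<open>x j\<close> and an unmatched vertex \<open>u \<in> U\<close> contributes \<open>D u\<close>. Edges from \<open>u\<close> to
vertices outside the list, which may still be used arbitrarily often, are accounted for in \<open>D u\<close>.
\<close>

primrec matching_sum :: "('b \<Rightarrow> 'a set) \<Rightarrow> ('b \<Rightarrow> 'r::comm_semiring_1) \<Rightarrow> ('a \<Rightarrow> 'r) \<Rightarrow> 'b list \<Rightarrow> 'a set \<Rightarrow> 'r"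
  where
    "matching_sum N x D [] U = (\<Prod>u\<in>U. D u)"
  | "matching_sum N x D (j # ts) U = matching_sum N x D ts U + x j * (\<Sum>u\<in>U \<inter> N j. matching_sum N x D ts (U - {u}))"

lemma matching_sum_cong:
  assumes "\<And>j. j \<in> set ts \<Longrightarrow> x j = x' j" "\<And>u. u \<in> U \<Longrightarrow> D u = D' u"
  shows "matching_sum N x D ts U = matching_sum N x' D' ts U"
  using assms
proof (induction ts arbitrary: U)
  case (Cons j ts)
  have "matching_sum N x D ts U = matching_sum N x' D' ts U"
    by (rule Cons.IH) (use Cons.prems in auto)
  moreover have "matching_sum N x D ts (U - {u}) = matching_sum N x' D' ts (U - {u})" for u
    by (rule Cons.IH) (use Cons.prems in auto)
  ultimately show ?case using Cons.prems by simp
qed simp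

text \<open>Only sums and products occur in the recursion. The use is with \<open>h\<close> the
  evaluation at a real or complex point, which takes polynomial weights to numbers.\<close>

lemma matching_sum_hom:
  assumes add: "\<And>p q. h (p + q) = h p + h q" and mult: "\<And>p q. h (p * q) = h p * h q"
    and "h 0 = 0" and "h 1 = 1"
  shows "h (matching_sum N x D ts U) = matching_sum N (\<lambda>j. h (x j)) (\<lambda>u. h (D u)) ts U"
proof -
  have sum: "h (sum f S) = (\<Sum>s\<in>S. h (f s))" for f :: "'x \<Rightarrow> _" and S
    by (induction S rule: infinite_finite_induct) (simp_all add: assms)
  have prod: "h (prod f S) = (\<Prod>s\<in>S. h (f s))" for f :: "'x \<Rightarrow> _" and S
    by (induction S rule: infinite_finite_induct) (simp_all add: assms)
  show ?thesis
    by (induction ts arbitrary: U) (simp_all add: sum prod add mult)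
qed

text \<open>In each term every vertex of \<open>U\<close> accounts for exactly one factor: its own
  \<open>D u\<close>, or the \<open>x j\<close> of its partner. Rescaling all weights is what later
  allows a rotation of the complex plane.\<close>

lemma matching_sum_homogeneous:
  assumes "finite U"
  shows "matching_sum N (\<lambda>j. c * x j) (\<lambda>u. c * D u) ts U = c ^ card U * matching_sum N x D ts U"
  using assms
proof (induction ts arbitrary: U)
  case Nil
  then show ?case by (simp add: prod.distrib)
next
  case (Cons j ts)
  have "c * x j * (\<Sum>u\<in>U \<inter> N j. matching_sum N (\<lambda>j. c * x j) (\<lambda>u. c * D u) ts (U - {u}))
      = c ^ card U * (x j * (\<Sum>u\<in>U \<inter> N j. matching_sum N x D ts (U - {u})))"
  proof -
    have "c * matching_sum N (\<lambda>j. c * x j) (\<lambda>u. c * D u) ts (U - {u}) = c ^ card U * matching_sum N x D ts (U - {u})"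
      if "u \<in> U" for u
    proof -
      have "c * c ^ card (U - {u}) = c ^ card U"
        using card_Suc_Diff1[OF Cons.prems that] by (metis power_Suc)
      then show ?thesis using Cons by (simp add: mult.assoc[symmetric])
    qed
    then have "(\<Sum>u\<in>U \<inter> N j. c * matching_sum N (\<lambda>j. c * x j) (\<lambda>u. c * D u) ts (U - {u}))
        = (\<Sum>u\<in>U \<inter> N j. c ^ card U * matching_sum N x D ts (U - {u}))"
      by (intro sum.cong) auto
    then show ?thesis
      by (simp add: sum_distrib_left[symmetric] mult.assoc mult.left_commute[of c] mult.left_commute[of "x j"])
  qed
  then show ?case using Cons by (simp add: algebra_simps)
qed

text \<open>The terms are sorted by whether \<open>u\<close> is unmatched. Setting
  \<open>D u\<close> to \<open>0\<close> leaves exactly those in which \<open>u\<close> is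
  matched.\<close>

lemma matching_sum_affine:
  assumes "finite U" "u \<in> U"
  shows "matching_sum N x D ts U = D u * matching_sum N x D ts (U - {u}) + matching_sum N x (D(u := 0)) ts U"
  using assms
proof (induction ts arbitrary: U)
  case Nil
  then show ?case by (simp add: prod.remove[of U u])
next
  case (Cons j ts)
  let ?D = "D(u := 0)"
  have other: "matching_sum N x D ts (U - {w}) = D u * matching_sum N x D ts (U - {u} - {w}) + matching_sum N x ?D ts (U - {w})"
    if "w \<noteq> u" for w
    using Cons.IH[of "U - {w}"] Cons.prems that by (simp add: Diff_insert2[symmetric] insert_commute del: fun_upd_apply)
  \<comment> \<open>The summand in which \<open>j\<close> takes \<open>u\<close> itself never sees
    \<open>D u\<close>, so it belongs wholly to the second part.\<close>
  have same: "matching_sum N x D ts (U - {u}) = matching_sum N x ?D ts (U - {u})"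
    by (rule matching_sum_cong) auto
  have "(\<Sum>w\<in>U \<inter> N j. matching_sum N x D ts (U - {w}))
      = D u * (\<Sum>w\<in>(U - {u}) \<inter> N j. matching_sum N x D ts (U - {u} - {w}))
        + (\<Sum>w\<in>U \<inter> N j. matching_sum N x ?D ts (U - {w}))"
  proof -
    have rest: "(\<Sum>w\<in>(U - {u}) \<inter> N j. matching_sum N x D ts (U - {w}))
        = D u * (\<Sum>w\<in>(U - {u}) \<inter> N j. matching_sum N x D ts (U - {u} - {w}))
          + (\<Sum>w\<in>(U - {u}) \<inter> N j. matching_sum N x ?D ts (U - {w}))"
      by (subst sum_distrib_left, subst sum.distrib[symmetric], rule sum.cong) (auto simp: other)
    show ?thesis
    proof (cases "u \<in> N j")
      case True
      then have "U \<inter> N j = insert u ((U - {u}) \<inter> N j)" using Cons.prems by auto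
      then show ?thesis using rest same Cons.prems by (simp add: ac_simps)
    next
      case False
      then have "(U - {u}) \<inter> N j = U \<inter> N j" by auto
      then show ?thesis using rest by simp
    qed
  qed
  then show ?case using Cons.IH[OF Cons.prems]
    by (simp add: algebra_simps del: fun_upd_apply)
qed

lemma matching_sum_pos:
  fixes D :: "'a \<Rightarrow> real"
  assumes "finite U" "\<And>j. j \<in> set ts \<Longrightarrow> x j > 0" "\<And>u. u \<in> U \<Longrightarrow> D u > 0"
  shows "matching_sum N x D ts U > 0"
  using assms
proof (induction ts arbitrary: U)
  case Nil
  then show ?case by (simp add: prod_pos)
next
  case (Cons j ts)
  have "0 \<le> (\<Sum>u\<in>U \<inter> N j. matching_sum N x D ts (U - {u}))"
    using Cons by (intro sum_nonneg less_imp_le Cons.IH) auto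
  then show ?case using Cons by (simp add: add_pos_nonneg less_imp_le)
qed

section \<open>Zero-free regions of the matching sum\<close>

lemma Re_inverse_pos: "Re z > 0 \<Longrightarrow> Re (inverse z) > 0"
  by (simp add: sum_power2_gt_zero_iff)

text \<open>
\<open>matching_sum\<close> is affine in each \<open>D u\<close>, so its zero in \<open>D u\<close> lies in the closed left half-plane. This bounds the
real part of the ratios that occur when one more vertex is added to the list.
\<close>

lemma matching_sum_stable:
  fixes D :: "'a \<Rightarrow> complex"
  assumes "finite U" "\<And>j. j \<in> set ts \<Longrightarrow> Re (x j) > 0" "\<And>u. u \<in> U \<Longrightarrow> Re (D u) > 0"
  shows "matching_sum N x D ts U \<noteq> 0"
  using assms
proof (induction ts arbitrary: U D)
  case Nil
  then show ?case by force
next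
  case (Cons j ts)
  have IH: "matching_sum N x D' ts V \<noteq> 0" if "finite V" "\<And>u. u \<in> V \<Longrightarrow> Re (D' u) > 0" for V D'
    using Cons that by simp
  have ratio: "Re (matching_sum N x D ts (U - {u}) / matching_sum N x D ts U) > 0" if "u \<in> U" for u
  proof -
    let ?A = "matching_sum N x D ts (U - {u})" and ?B = "matching_sum N x (D(u := 0)) ts U"
    have A: "?A \<noteq> 0" using Cons.prems by (intro IH) auto
    have "Re (?B / ?A) \<ge> 0"
    proof (rule ccontr)
      assume neg: "\<not> Re (?B / ?A) \<ge> 0"
      \<comment> \<open>This value is the zero of the affine function in \<open>D u\<close>. By
        assumption its real part is positive, so the induction hypothesis forbids the zero.\<close>
      let ?D = "D(u := - (?B / ?A))"
      have "matching_sum N x ?D ts U = ?D u * matching_sum N x ?D ts (U - {u}) + matching_sum N x (?D(u := 0)) ts U"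
        using Cons.prems(1) that by (rule matching_sum_affine)
      also have "matching_sum N x ?D ts (U - {u}) = ?A" by (rule matching_sum_cong) auto
      also have "matching_sum N x (?D(u := 0)) ts U = ?B" by (rule matching_sum_cong) auto
      also have "?D u * ?A + ?B = 0" using A by simp
      finally have "matching_sum N x ?D ts U = 0" .
      moreover have "matching_sum N x ?D ts U \<noteq> 0"
        using Cons.prems neg by (intro IH) auto
      ultimately show False by contradiction
    qed
    moreover have "matching_sum N x D ts U / ?A = D u + ?B / ?A"
      using matching_sum_affine[OF Cons.prems(1) that, of N x D ts] A by (simp add: field_simps)
    ultimately have "Re (matching_sum N x D ts U / ?A) > 0"
      using Cons.prems(3)[OF that] by simp
    then have "Re (inverse (matching_sum N x D ts U / ?A)) > 0"
      by (rule Re_inverse_pos)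
    then show ?thesis by simp
  qed
  have U: "matching_sum N x D ts U \<noteq> 0" using Cons.prems by (intro IH) auto
  let ?S = "\<Sum>u\<in>U \<inter> N j. matching_sum N x D ts (U - {u}) / matching_sum N x D ts U"
  have S: "Re ?S \<ge> 0"
    unfolding Re_sum using ratio by (intro sum_nonneg) (auto intro: less_imp_le)
  \<comment> \<open>Otherwise \<open>?S\<close> would be \<open>- inverse (x j)\<close>, with
    negative real part.\<close>
  have "1 + x j * ?S \<noteq> 0"
  proof
    assume "1 + x j * ?S = 0"
    moreover have xj: "Re (x j) > 0" using Cons.prems by simp
    moreover have "x j \<noteq> 0" using xj by force
    moreover have "S = - inverse c" if "1 + c * S = 0" "c \<noteq> 0" for S c :: complex
      using that by (simp add: field_simps add_eq_0_iff)
    ultimately have "?S = - inverse (x j)" by blast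
    then have "Re ?S = - Re (inverse (x j))" by simp
    then show False using S Re_inverse_pos[OF xj] by linarith
  qed
  moreover have "matching_sum N x D (j # ts) U = matching_sum N x D ts U * (1 + x j * ?S)"
    using U by (simp add: sum_divide_distrib[symmetric] distrib_left)
  ultimately show ?case using U by simp
qed

text \<open>For such \<open>t\<close> some open half-plane bounded by a line through
  \<open>0\<close> contains \<open>1\<close> and \<open>t\<close>, hence all the weights. By
  homogeneity it may be rotated to the right half-plane, where \<open>matching_sum_stable\<close>
  applies.\<close>

lemma matching_sum_nonzero_off_negative_axis:
  assumes "finite U" and t: "\<not> (t \<in> \<real> \<and> Re t \<le> 0)"
    and x: "\<And>j. j \<in> set ts \<Longrightarrow> x0 j \<ge> 0 \<and> x1 j \<ge> 0 \<and> x0 j + x1 j > (0::real)"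
    and d: "\<And>u. u \<in> U \<Longrightarrow> d0 u \<ge> 0 \<and> d1 u \<ge> 0 \<and> d0 u + d1 u > (0::real)"
  shows "matching_sum N (\<lambda>j. of_real (x0 j) + of_real (x1 j) * t) (\<lambda>u. of_real (d0 u) + of_real (d1 u) * t) ts U
           \<noteq> (0::complex)"
proof -
  \<comment> \<open>multiplication by \<open>w\<close> rotates both \<open>1\<close> and \<open>t\<close> into the right half-plane\<close>
  define w where "w = 1 + cnj t / of_real (norm t)"
  have t0: "t \<noteq> 0" using t by auto
  \<comment> \<open>Both \<open>Re w > 0\<close> and \<open>Re (w * t) > 0\<close> reduce to this,
    because \<open>w * t = t + norm t\<close>.\<close>
  have lt: "- Re t < norm t"
  proof (rule ccontr)
    assume "\<not> - Re t < norm t"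
    then have eq: "norm t = - Re t" using abs_Re_le_cmod[of t] by linarith
    then have "(Re t)\<^sup>2 + (Im t)\<^sup>2 = (Re t)\<^sup>2"
      using cmod_power2[of t] by simp
    then have "Im t = 0" by simp
    then show False using t eq norm_ge_zero[of t] by (simp add: complex_is_Real_iff)
  qed
  have w: "Re w > 0" using lt t0 by (simp add: w_def field_simps)
  have "cnj t * t = of_real (norm t) * of_real (norm t)"
    using complex_norm_square[of t] by (simp add: power2_eq_square mult.commute)
  then have "w * t = t + of_real (norm t)" using t0 by (simp add: w_def distrib_right)
  then have wt: "Re (w * t) > 0" using lt by simp
  have pos: "Re (w * (of_real p + of_real q * t)) > 0" if "p \<ge> 0 \<and> q \<ge> 0 \<and> p + q > 0" for p q :: real
  proof -
    have "w * (of_real p + of_real q * t) = of_real p * w + of_real q * (w * t)"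
      by (simp add: algebra_simps)
    then have "Re (w * (of_real p + of_real q * t)) = p * Re w + q * Re (w * t)"
      by simp
    moreover have "p * Re w + q * Re (w * t) > 0"
      using that w wt by (cases "p = 0") (auto intro: add_pos_nonneg)
    ultimately show ?thesis by simp
  qed
  have "matching_sum N (\<lambda>j. w * (of_real (x0 j) + of_real (x1 j) * t))
      (\<lambda>u. w * (of_real (d0 u) + of_real (d1 u) * t)) ts U \<noteq> 0"
    using assms by (intro matching_sum_stable pos) auto
  then show ?thesis unfolding matching_sum_homogeneous[OF \<open>finite U\<close>] by auto
qed

section \<open>The matching sum as a polynomial in one variable\<close>

text \<open>Each \<open>u\<close> brings one factor to a term, and \<open>w u\<close> bounds the
  degree of any factor that it can bring; the degree of \<open>x j\<close> is charged to the partner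
  of \<open>j\<close>.\<close>

lemma matching_sum_degree:
  assumes "finite U" "\<And>u. u \<in> U \<Longrightarrow> degree (D u) \<le> w u"
    "\<And>j u. j \<in> set ts \<Longrightarrow> u \<in> U \<inter> N j \<Longrightarrow> degree (x j) \<le> w u"
  shows "degree (matching_sum N x D ts U) \<le> (\<Sum>u\<in>U. w u)"
  using assms
proof (induction ts arbitrary: U)
  case Nil
  have "degree (\<Prod>u\<in>U. D u) \<le> (\<Sum>u\<in>U. degree (D u))"
    using degree_prod_sum_le[of U D] Nil by (simp add: o_def)
  also have "\<dots> \<le> (\<Sum>u\<in>U. w u)" using Nil by (intro sum_mono) auto
  finally show ?case by simp
next
  case (Cons j ts)
  have "degree (x j * matching_sum N x D ts (U - {u})) \<le> (\<Sum>u\<in>U. w u)" if "u \<in> U \<inter> N j" for u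
  proof -
    have "degree (matching_sum N x D ts (U - {u})) \<le> (\<Sum>u\<in>U - {u}. w u)"
      using Cons by (intro Cons.IH) auto
    moreover have "degree (x j) \<le> w u" using Cons.prems that by auto
    moreover have "(\<Sum>u\<in>U. w u) = w u + (\<Sum>u\<in>U - {u}. w u)"
      using Cons.prems that by (intro sum.remove) auto
    ultimately show ?thesis using degree_mult_le[of "x j" "matching_sum N x D ts (U - {u})"] by linarith
  qed
  then have "degree (x j * (\<Sum>u\<in>U \<inter> N j. matching_sum N x D ts (U - {u}))) \<le> (\<Sum>u\<in>U. w u)"
    unfolding sum_distrib_left using Cons.prems(1) by (intro degree_sum_le) auto
  moreover have "degree (matching_sum N x D ts U) \<le> (\<Sum>u\<in>U. w u)" using Cons by (intro Cons.IH) auto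
  ultimately show ?case by (auto intro: degree_add_le)
qed

lemma coeff_0_prod: "coeff (prod f S) 0 = (\<Prod>s\<in>S. coeff (f s) 0)"
  by (simp add: poly_0_coeff_0[symmetric] poly_prod)

lemma coeff_1_mult: "coeff (p * q) 1 = coeff p 0 * coeff q 1 + coeff p 1 * coeff q 0"
  by (simp add: coeff_mult)

lemma matching_sum_coeff_0:
  "coeff (matching_sum N (\<lambda>j. [:x j:]) (\<lambda>u. [:d u, e u:]) ts U) 0 = matching_sum N x d ts U"
  by (induction ts arbitrary: U) (simp_all add: coeff_0_prod coeff_sum)

text \<open>Product rule: one unmatched \<open>u\<close> supplies its slope \<open>e u\<close>, all
  others their constant term. With \<open>e\<close> the indicator of \<open>N j\<close> this is the
  sum in the recursion for \<open>j # ts\<close>, so cutting off after the linear term adds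
  \<open>j\<close> to the list.\<close>

lemma matching_sum_coeff_1:
  assumes "finite U"
  shows "coeff (matching_sum N (\<lambda>j. [:x j:]) (\<lambda>u. [:d u, e u:]) ts U) 1 = (\<Sum>u\<in>U. e u * matching_sum N x d ts (U - {u}))"
  using assms
proof (induction ts arbitrary: U)
  case Nil
  have "coeff (\<Prod>u\<in>U. [:d u, e u:]) 1 = (\<Sum>u\<in>U. e u * prod d (U - {u}))"
    using Nil
  proof (induction U rule: finite_induct)
    case (insert w U)
    have "prod d (insert w U - {u}) = d w * prod d (U - {u})" if "u \<in> U" for u
      using insert that by (subst insert_Diff_if) auto
    then have "(\<Sum>u\<in>U. e u * prod d (insert w U - {u})) = d w * (\<Sum>u\<in>U. e u * prod d (U - {u}))"
      unfolding sum_distrib_left by (intro sum.cong) (auto simp: mult_ac)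
    then show ?case using insert
      by (simp add: coeff_1_mult[unfolded One_nat_def] coeff_0_prod add.commute del: mult_pCons_left)
  qed simp
  then show ?case by simp
next
  case (Cons j ts)
  have "(\<Sum>w\<in>U \<inter> N j. \<Sum>u\<in>U - {w}. e u * matching_sum N x d ts (U - {w} - {u}))
      = (\<Sum>u\<in>U. e u * (\<Sum>w\<in>(U - {u}) \<inter> N j. matching_sum N x d ts (U - {u} - {w})))"
  proof -
    have "(\<Sum>w\<in>U \<inter> N j. \<Sum>u\<in>U - {w}. e u * matching_sum N x d ts (U - {w} - {u}))
        = (\<Sum>w\<in>U \<inter> N j. \<Sum>u | u \<in> U \<and> u \<noteq> w. e u * matching_sum N x d ts (U - {u} - {w}))"
      by (intro sum.cong) (auto simp: Diff_insert2[symmetric] insert_commute)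
    also have "\<dots> = (\<Sum>u\<in>U. \<Sum>w | w \<in> U \<inter> N j \<and> u \<noteq> w. e u * matching_sum N x d ts (U - {u} - {w}))"
      using Cons.prems by (intro sum.swap_restrict) auto
    also have "\<dots> = (\<Sum>u\<in>U. \<Sum>w\<in>(U - {u}) \<inter> N j. e u * matching_sum N x d ts (U - {u} - {w}))"
      by (intro sum.cong) auto
    finally show ?thesis by (simp add: sum_distrib_left)
  qed
  moreover have "(\<Sum>u\<in>U. e u * (f u + x j * g u)) = (\<Sum>u\<in>U. e u * f u) + x j * (\<Sum>u\<in>U. e u * g u)" for f g
    by (simp add: distrib_left sum.distrib sum_distrib_left mult_ac)
  ultimately show ?case using Cons by (simp add: coeff_sum)
qed

section \<open>Real-rooted polynomials\<close>

text \<open>Roots are split off by the fundamental theorem of algebra. The nonzero constant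
  coefficient excludes the root \<open>0\<close>, so a root \<open>r\<close> gives the positive
  number \<open>- (1 / r)\<close>; with factors normalised to \<open>1\<close> at \<open>0\<close>,
  the sum of \<open>L\<close> is the relative linear coefficient.\<close>

lemma real_rooted_factor:
  fixes p :: "real poly"
  assumes "\<And>z. poly (map_poly of_real p) z = (0::complex) \<Longrightarrow> z \<in> \<real> \<and> Re z \<le> 0"
    and "coeff p 0 \<noteq> 0"
  shows "\<exists>L. (\<forall>l\<in>#L. 0 < l) \<and> size L = degree p \<and> p = smult (coeff p 0) (\<Prod>l\<in>#L. [:1, l:])"
  using assms
proof (induction "degree p" arbitrary: p)
  case 0
  then obtain c where "p = [:c:]" by (metis degree_eq_zeroE)
  then show ?case using 0 by (intro exI[of _ "{#}"]) simp
next
  case (Suc n)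
  let ?c = "map_poly complex_of_real"
  have c: "?c (q * r) = ?c q * ?c r" for q r
    by (intro poly_eqI) (simp add: coeff_map_poly coeff_mult)
  have "\<not> constant (poly (?c p))"
    using Suc(2) by (simp add: constant_degree degree_map_poly)
  then obtain z where z: "poly (?c p) z = 0"
    using fundamental_theorem_of_algebra by blast
  with Suc.prems(1) have "z \<in> \<real>" "Re z \<le> 0" by auto
  then obtain r where r: "z = of_real r" "r \<le> 0" by (auto elim: Reals_cases)
  have "complex_of_real (poly p r) = poly (?c p) z"
    by (simp add: r poly_altdef degree_map_poly coeff_map_poly)
  then have root: "poly p r = 0" using z by simp
  then have "r \<noteq> 0" using Suc.prems(2) by (auto simp: poly_0_coeff_0)
  with r have neg: "r < 0" by simp
  obtain q where q: "p = [:- r, 1:] * q" using root by (auto simp: poly_eq_0_iff_dvd)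
  have q0: "coeff p 0 = - r * coeff q 0" unfolding q by (simp add: coeff_mult)
  have deg: "degree p = Suc (degree q)"
    using Suc.prems(2) q0 unfolding q by (subst degree_mult_eq) auto
  obtain L where L: "\<forall>l\<in>#L. 0 < l" "size L = degree q" "q = smult (coeff q 0) (\<Prod>l\<in>#L. [:1, l:])"
  proof (atomize_elim, rule Suc.hyps(1))
    show "n = degree q" using Suc.hyps(2) deg by simp
    show "z \<in> \<real> \<and> Re z \<le> 0" if "poly (map_poly of_real q) z = 0" for z :: complex
      using Suc.prems(1)[of z] that unfolding q c by simp
    show "coeff q 0 \<noteq> 0" using q0 Suc.prems(2) by auto
  qed
  have "[:- r, 1:] = smult (- r) [:1, - (1 / r):]" using neg by simp
  then have "p = smult (- r) [:1, - (1 / r):] * smult (coeff q 0) (\<Prod>l\<in>#L. [:1, l:])"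
    using q L(3) by metis
  then have "p = smult (coeff p 0) (\<Prod>l\<in>#add_mset (- (1 / r)) L. [:1, l:])"
    unfolding q0 by (simp only: mult_smult_left mult_smult_right smult_smult image_mset_add_mset
        prod_mset.add_mset mult.commute)
  then show ?case using L neg deg
    by (intro exI[of _ "add_mset (- (1 / r)) L"]) auto
qed

text \<open>Evaluation at \<open>z\<close> produces affine weights, to which the zero-free region
  applies. Either the \<open>D u\<close> carry the variable (for the truncations) or the
  \<open>x j\<close> (for the generating function of the matchings).\<close>

lemma matching_sum_real_rooted:
  fixes d e :: "'a \<Rightarrow> real"
  assumes "finite U"
    and x: "\<And>j. j \<in> set ts \<Longrightarrow> x j \<ge> 0 \<and> y j \<ge> 0 \<and> x j + y j > 0"
    and d: "\<And>u. u \<in> U \<Longrightarrow> d u \<ge> 0 \<and> e u \<ge> 0 \<and> d u + e u > 0"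
    and zero: "poly (map_poly of_real (matching_sum N (\<lambda>j. [:x j, y j:]) (\<lambda>u. [:d u, e u:]) ts U)) z = (0::complex)"
  shows "z \<in> \<real> \<and> Re z \<le> 0"
proof (rule ccontr)
  assume z: "\<not> (z \<in> \<real> \<and> Re z \<le> 0)"
  let ?h = "\<lambda>p. poly (map_poly complex_of_real p) z"
  have linear: "?h [:p, q:] = of_real p + of_real q * z" for p q
    by (simp add: map_poly_pCons mult.commute)
  have "?h (matching_sum N (\<lambda>j. [:x j, y j:]) (\<lambda>u. [:d u, e u:]) ts U)
      = matching_sum N (\<lambda>j. ?h [:x j, y j:]) (\<lambda>u. ?h [:d u, e u:]) ts U"
  proof (rule matching_sum_hom)
    have "map_poly complex_of_real (p + q) = map_poly of_real p + map_poly of_real q" for p q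
      by (intro poly_eqI) (simp add: coeff_map_poly)
    then show "?h (p + q) = ?h p + ?h q" for p q by simp
    have "map_poly complex_of_real (p * q) = map_poly of_real p * map_poly of_real q" for p q
      by (intro poly_eqI) (simp add: coeff_map_poly coeff_mult)
    then show "?h (p * q) = ?h p * ?h q" for p q by simp
  qed (simp_all add: map_poly_1)
  then show False
    using matching_sum_nonzero_off_negative_axis[OF assms(1) z, of ts x y d e N] x d zero by (simp add: linear)
qed

section \<open>Newton's inequalities\<close>

text \<open>The difference of the two sides is a nonnegative combination of the three hypotheses
  plus the square of \<open>e2 - l * e1\<close>. The numbers \<open>e0\<close> to \<open>e3\<close>
  are consecutive normalised coefficients; the factors \<open>m - 1\<close> and \<open>i - 1\<close>
  make the hypotheses trivial at the ends, where \<open>e3\<close> or \<open>e0\<close> is out of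
  range.\<close>

lemma newton_step:
  fixes l m i e0 e1 e2 e3 :: real
  assumes "l \<ge> 0" "m \<ge> 1" "i \<ge> 1"
    and 1: "(m - 1) * (e1 * e3) \<le> (m - 1) * e2\<^sup>2"
    and 2: "(i - 1) * (e0 * e2) \<le> (i - 1) * e1\<^sup>2"
    and 3: "(m - 1) * (i - 1) * (e0 * e3) \<le> (m - 1) * (i - 1) * (e1 * e2)"
  shows "((m + 1) * e1 + l * (i - 1) * e0) * ((m - 1) * e3 + l * (i + 1) * e2) \<le> (m * e2 + l * i * e1)\<^sup>2"
proof -
  have "(m * e2 + l * i * e1)\<^sup>2 - ((m + 1) * e1 + l * (i - 1) * e0) * ((m - 1) * e3 + l * (i + 1) * e2)
      = (m + 1) * ((m - 1) * e2\<^sup>2 - (m - 1) * (e1 * e3))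
        + l\<^sup>2 * (i + 1) * ((i - 1) * e1\<^sup>2 - (i - 1) * (e0 * e2))
        + l * ((m - 1) * (i - 1) * (e1 * e2) - (m - 1) * (i - 1) * (e0 * e3))
        + (e2 - l * e1)\<^sup>2"
    by (simp add: algebra_simps power2_eq_square)
  also have "\<dots> \<ge> 0"
    using assms by (intro add_nonneg_nonneg mult_nonneg_nonneg) auto
  finally show ?thesis by simp
qed

text \<open>\<open>E i\<close> is meant as a coefficient divided by \<open>n choose i\<close>. The
  middle clause forbids internal zeros, which would break the comparison of distant entries.\<close>

definition ultra_log_concave :: "nat \<Rightarrow> (nat \<Rightarrow> real) \<Rightarrow> bool" where
  "ultra_log_concave n E \<longleftrightarrow> (\<forall>i\<le>n. E i \<ge> 0) \<and> (\<forall>i<n. E (Suc i) > 0 \<longrightarrow> E i > 0)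
     \<and> (\<forall>i. i + 2 \<le> n \<longrightarrow> E i * E (i + 2) \<le> (E (i + 1))\<^sup>2)"

lemma newton_inequalities:
  fixes L :: "real multiset"
  assumes "\<forall>l\<in>#L. l \<ge> 0"
  shows "\<exists>E :: nat \<Rightarrow> real. ultra_log_concave (size L) E \<and> (\<forall>i. coeff (\<Prod>l\<in>#L. [:1, l:]) i = (size L choose i) * E i)"
  using assms
proof (induction L)
  case empty
  show ?case
    by (intro exI[of _ "\<lambda>_. 1"]) (auto simp: ultra_log_concave_def one_pCons coeff_pCons split: nat.split)
next
  case (add l L)
  define n where "n = size L"
  define p where "p = (\<Prod>l\<in>#L. [:1, l:])"
  from add obtain E :: "nat \<Rightarrow> real" where ulc: "ultra_log_concave n E" and c: "\<And>i. coeff p i = (n choose i) * E i"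
    unfolding n_def p_def by auto
  have nonneg: "E i \<ge> 0" if "i \<le> n" for i using ulc that by (auto simp: ultra_log_concave_def)
  have pos: "E i > 0" if "i < n" "E (Suc i) > 0" for i using ulc that by (auto simp: ultra_log_concave_def)
  have lc: "E i * E (i + 2) \<le> (E (i + 1))\<^sup>2" if "i + 2 \<le> n" for i
    using ulc that by (auto simp: ultra_log_concave_def)
  have l: "l \<ge> 0" using add by simp
  \<comment> \<open>The new coefficient is the old one plus \<open>l\<close> times its predecessor;
    division by \<open>Suc n choose i\<close> turns the binomials into these weights. The
    out-of-range entries at \<open>i = 0\<close> and \<open>i = Suc n\<close> get weight
    \<open>0\<close>.\<close>
  define E' where "E' = (\<lambda>i. ((real n + 1 - i) * E i + l * i * E (i - 1)) / (n + 1))"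
  have E': "(n + 1) * E' i = (real n + 1 - i) * E i + l * i * E (i - 1)" for i
    by (simp add: E'_def)
  have nonneg': "E' i \<ge> 0" if "i \<le> Suc n" for i
  proof (cases "i = Suc n")
    case True
    then show ?thesis using l nonneg[of n] by (simp add: E'_def)
  next
    case False
    then show ?thesis using l that nonneg[of i] nonneg[of "i - 1"]
      unfolding E'_def by (intro divide_nonneg_nonneg add_nonneg_nonneg mult_nonneg_nonneg) auto
  qed
  have pos': "E' i > 0" if "i \<le> n" "E' (Suc i) > 0" for i
  proof -
    have E'S: "(real n - i) * E (Suc i) + l * (i + 1) * E i > 0"
      using that(2) by (simp add: E'_def zero_less_divide_iff algebra_simps split: if_splits)
    have "E i > 0"
    proof (rule ccontr)
      assume "\<not> E i > 0"
      then have 0: "E i = 0" using nonneg[OF that(1)] by simp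
      then have "i < n \<Longrightarrow> E (Suc i) = 0" using pos[of i] nonneg[of "Suc i"] by force
      then have z: "(real n - i) * E (Suc i) = 0" using that(1) by (cases "i = n") auto
      show False using E'S unfolding z 0 by simp
    qed
    then have "(real n + 1 - i) * E i + l * i * E (i - 1) > 0"
      using that(1) l nonneg[of "i - 1"] by (intro add_pos_nonneg mult_pos_pos mult_nonneg_nonneg) auto
    then show ?thesis by (simp add: E'_def)
  qed
  have lc': "E' i * E' (i + 2) \<le> (E' (i + 1))\<^sup>2" if "i + 2 \<le> Suc n" for i
  proof -
    have step: "(((real n - i) + 1) * E i + l * (real (i + 1) - 1) * E (i - 1))
          * (((real n - i) - 1) * E (i + 2) + l * (real (i + 1) + 1) * E (i + 1))
        \<le> ((real n - i) * E (i + 1) + l * real (i + 1) * E i)\<^sup>2"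
    proof (rule newton_step)
      show "(real n - i - 1) * (E i * E (i + 2)) \<le> (real n - i - 1) * (E (i + 1))\<^sup>2"
      proof (cases "i + 2 \<le> n")
        case True
        then show ?thesis using lc[of i] by (intro mult_left_mono) auto
      next
        case False
        then have "n = Suc i" using that by simp
        then show ?thesis by simp
      qed
      show "(real (i + 1) - 1) * (E (i - 1) * E (i + 1)) \<le> (real (i + 1) - 1) * (E i)\<^sup>2"
        using lc[of "i - 1"] that by (cases "i = 0") (auto intro!: mult_left_mono)
      show "(real n - i - 1) * (real (i + 1) - 1) * (E (i - 1) * E (i + 2))
          \<le> (real n - i - 1) * (real (i + 1) - 1) * (E i * E (i + 1))"
      proof (cases "i = 0 \<or> i + 2 > n")
        case True
        moreover have "real n - i - 1 = 0" if "i + 2 > n" using that \<open>i + 2 \<le> Suc n\<close> by linarith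
        ultimately show ?thesis by auto
      next
        case False
        then have i: "0 < i" "i + 2 \<le> n" by auto
        have "E (i - 1) * E (i + 2) \<le> E i * E (i + 1)"
        proof (cases "E (i + 2) = 0")
          case True
          then show ?thesis using nonneg[of i] nonneg[of "i + 1"] i by simp
        next
          case False
          then have p2: "E (i + 2) > 0" using nonneg[OF i(2)] by simp
          then have p1: "E (i + 1) > 0" using pos[of "i + 1"] i by simp
          then have p0: "E i > 0" using pos[of i] i by simp
          \<comment> \<open>Two neighbouring inequalities are multiplied, and the common factor
            \<open>E i * E (i + 1)\<close> cancels. It is positive because there are no internal
            zeros.\<close>
          have "(E (i - 1) * E (i + 1)) * (E i * E (i + 2)) \<le> (E i)\<^sup>2 * (E (i + 1))\<^sup>2"
            using lc[of "i - 1"] lc[of i] i p0 p2 by (intro mult_mono) auto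
          then have "(E (i - 1) * E (i + 2)) * (E i * E (i + 1)) \<le> (E i * E (i + 1)) * (E i * E (i + 1))"
            by (simp add: power2_eq_square mult_ac)
          then show ?thesis using p0 p1 by (simp add: mult_le_cancel_right)
        qed
        then show ?thesis using i by (intro mult_left_mono) auto
      qed
    qed (use l that in auto)
    have "((n + 1) * E' i) * ((n + 1) * E' (i + 2)) \<le> ((n + 1) * E' (i + 1))\<^sup>2"
      unfolding E' using step by (simp add: algebra_simps)
    then have "(real n + 1)\<^sup>2 * (E' i * E' (i + 2)) \<le> (real n + 1)\<^sup>2 * (E' (i + 1))\<^sup>2"
      by (simp add: power2_eq_square mult_ac add.commute)
    then show ?thesis by (simp add: mult_le_cancel_left)
  qed
  have coeff': "coeff (\<Prod>l\<in>#add_mset l L. [:1, l:]) i = (Suc n choose i) * E' i" for i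
  proof (cases i)
    case 0
    then show ?thesis using c[of 0] by (simp add: p_def[symmetric] E'_def add.commute)
  next
    case (Suc k)
    have a: "(real n + 1) * (n choose k) = (real k + 1) * (Suc n choose Suc k)"
      using Suc_times_binomial[of k n] by (metis of_nat_Suc of_nat_mult add.commute)
    have pascal: "real (n choose Suc k) = real (Suc n choose Suc k) - real (n choose k)" by simp
    have b: "(real n + 1) * (n choose Suc k) = (real n - k) * (Suc n choose Suc k)"
      unfolding pascal right_diff_distrib a by (simp add: algebra_simps del: binomial_Suc_Suc)
    have "(real n + 1) * coeff (\<Prod>l\<in>#add_mset l L. [:1, l:]) i
        = ((real n + 1) * (n choose Suc k)) * E (Suc k) + l * ((real n + 1) * (n choose k)) * E k"
      by (simp add: Suc p_def[symmetric] c algebra_simps del: binomial_Suc_Suc)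
    also have "\<dots> = (Suc n choose Suc k) * ((real n - k) * E (Suc k) + l * (k + 1) * E k)"
      unfolding a b by (simp add: algebra_simps del: binomial_Suc_Suc)
    also have "\<dots> = (real n + 1) * ((Suc n choose i) * E' i)"
      by (simp add: Suc E'_def add.commute del: binomial_Suc_Suc)
    finally show ?thesis by (simp add: add_nonneg_eq_0_iff)
  qed
  show ?case
    using nonneg' pos' lc' coeff' unfolding ultra_log_concave_def n_def by (intro exI[of _ E']) auto
qed

section \<open>Extraction of one coefficient\<close>

text \<open>Ratios of successive entries decrease, so a geometric sequence that meets
  \<open>E\<close> at \<open>k\<close> with the ratio found there dominates \<open>E\<close> on both
  sides.\<close>

lemma ultra_log_concave_le_geometric:
  assumes "ultra_log_concave n E" "0 < k" "k \<le> n" "E k > 0"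
  obtains r where "r > 0" "\<And>i. i \<le> n \<Longrightarrow> E i * r ^ k \<le> E k * r ^ i"
proof -
  have nonneg: "E i \<ge> 0" if "i \<le> n" for i using assms(1) that by (auto simp: ultra_log_concave_def)
  have pos: "E i > 0" if "i < n" "E (Suc i) > 0" for i
    using assms(1) that by (auto simp: ultra_log_concave_def)
  have lc: "E i * E (i + 2) \<le> (E (i + 1))\<^sup>2" if "i + 2 \<le> n" for i
    using assms(1) that by (auto simp: ultra_log_concave_def)
  \<comment> \<open>The ratio to the left of \<open>k\<close> is positive; the one to the right may
    vanish, or be out of range for \<open>k = n\<close>.\<close>
  define r where "r = E k / E (k - 1)"
  have Ek1: "E (k - 1) > 0" using pos[of "k - 1"] assms by simp
  have r: "r > 0" using Ek1 assms by (simp add: r_def)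
  have up: "E (Suc i) \<le> r * E i" if "k - 1 \<le> i" "Suc i \<le> n" for i
    using that
  proof (induction i rule: dec_induct)
    case base
    then show ?case using assms Ek1 by (simp add: r_def)
  next
    case (step i)
    show ?case
    proof (cases "E (Suc i) > 0")
      case True
      then have p: "E i > 0" using pos step by simp
      have "E i * E (Suc (Suc i)) \<le> E (Suc i) * E (Suc i)"
        using lc[of i] step by (simp add: power2_eq_square)
      also have "\<dots> \<le> (r * E i) * E (Suc i)"
        using step True by (intro mult_right_mono) auto
      finally have "E i * E (Suc (Suc i)) \<le> E i * (r * E (Suc i))" by (simp add: mult_ac)
      then show ?thesis using p by simp
    next
      case False
      then have "E (Suc i) = 0" "E (Suc (Suc i)) = 0"
        using nonneg[of "Suc i"] nonneg[of "Suc (Suc i)"] pos[of "Suc i"] step by force+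
      then show ?thesis by simp
    qed
  qed
  have posle: "E i > 0" if "i \<le> k" for i
    using that
  proof (induction i rule: inc_induct)
    case base
    show ?case using assms by simp
  next
    case (step i)
    then show ?case using pos[of i] assms by simp
  qed
  have down: "r * E i \<le> E (Suc i)" if "i \<le> k - 1" for i
    using that
  proof (induction i rule: inc_induct)
    case base
    then show ?case using assms Ek1 by (simp add: r_def)
  next
    case (step i)
    then have p: "E (Suc i) > 0" using posle by simp
    have "E i \<ge> 0" using posle[of i] step(2) by linarith
    have "(r * E i) * E (Suc i) = E i * (r * E (Suc i))" by simp
    also have "\<dots> \<le> E i * E (Suc (Suc i))"
      using step(3) \<open>E i \<ge> 0\<close> by (intro mult_left_mono) auto
    also have "\<dots> \<le> E (Suc i) * E (Suc i)"
      using lc[of i] step assms by (simp add: power2_eq_square)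
    finally show ?case using p by simp
  qed
  have "E i * r ^ k \<le> E k * r ^ i" if "i \<le> n" for i
  proof (cases "i \<le> k")
    case True
    then show ?thesis
    proof (induction i rule: inc_induct)
      case (step i)
      have "r * E i * r ^ k \<le> E (Suc i) * r ^ k" using down[of i] step r by (intro mult_right_mono) auto
      also have "\<dots> \<le> r * (E k * r ^ i)" using step by (simp add: mult_ac)
      finally show ?case using r by (simp add: mult.assoc)
    qed simp
  next
    case False
    then have "k \<le> i" by simp
    then show ?thesis using that
    proof (induction i rule: dec_induct)
      case (step i)
      have "E (Suc i) * r ^ k \<le> r * E i * r ^ k" using up[of i] step r by (intro mult_right_mono) auto
      also have "\<dots> \<le> r * (E k * r ^ i)" using step r by (simp add: mult.assoc)
      finally show ?case by (simp add: mult_ac)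
    qed simp
  qed
  with r show thesis by (rule that)
qed

text \<open>Replacing \<open>E\<close> by the dominating geometric sequence turns the sum into a
  binomial power. The claim is then the value at the minimiser of
  \<open>(1 + y) ^ n / y ^ k\<close>.\<close>

lemma ultra_log_concave_coeff_ge:
  fixes K :: real and E :: "nat \<Rightarrow> real"
  assumes ulc: "ultra_log_concave n E" and k: "0 < k" "k \<le> n" and K: "K > 0"
    and lower: "\<And>t. t > 0 \<Longrightarrow> K * t ^ k \<le> (\<Sum>i\<le>n. (n choose i) * E i * t ^ i)"
  shows "E k \<ge> K * (real k / n) ^ k * (1 - real k / n) ^ (n - k)"
proof -
  have nonneg: "E i \<ge> 0" if "i \<le> n" for i using ulc that by (auto simp: ultra_log_concave_def)
  have pos: "E i > 0" if "i < n" "E (Suc i) > 0" for i using ulc that by (auto simp: ultra_log_concave_def)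
  have n: "n > 0" using k by simp
  have Ek: "E k > 0"
  proof (rule ccontr)
    assume "\<not> E k > 0"
    then have Ek: "E k = 0" using nonneg[of k] k by simp
    have zero: "E i = 0" if "k \<le> i" "i \<le> n" for i
      using that
    proof (induction i rule: dec_induct)
      case (step i)
      then show ?case using pos[of i] nonneg[of "Suc i"] by force
    qed (use Ek in simp)
    define S where "S = (\<Sum>i\<le>n. (n choose i) * E i)"
    have S: "S \<ge> 0" unfolding S_def using nonneg by (intro sum_nonneg) auto
    \<comment> \<open>If \<open>E k = 0\<close>, the sum has degree below \<open>k\<close> and
      cannot stay above \<open>K * t ^ k\<close>; this \<open>t\<close> is large enough, as
      \<open>K * t = S + K\<close>.\<close>
    define t where "t = S / K + 1"
    have t: "t \<ge> 1" using S K by (simp add: t_def)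
    have "(n choose i) * E i * t ^ i \<le> (n choose i) * E i * t ^ (k - 1)" if "i \<le> n" for i
    proof (cases "i < k")
      case True
      then show ?thesis using t nonneg[OF that] by (intro mult_left_mono power_increasing) auto
    qed (use zero that in auto)
    then have "(\<Sum>i\<le>n. (n choose i) * E i * t ^ i) \<le> S * t ^ (k - 1)"
      unfolding S_def sum_distrib_right by (intro sum_mono) auto
    with lower[of t] t have "K * t ^ k \<le> S * t ^ (k - 1)" by simp
    moreover have "t ^ k = t * t ^ (k - 1)" using k by (cases k) auto
    ultimately have "K * t \<le> S" using t by (simp add: mult.assoc[symmetric])
    moreover have "K * t = S + K" using K by (simp add: t_def distrib_left)
    ultimately show False using K by simp
  qed
  obtain r where r: "r > 0" and le: "\<And>i. i \<le> n \<Longrightarrow> E i * r ^ k \<le> E k * r ^ i"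
    using ultra_log_concave_le_geometric[OF ulc k Ek] by blast
  have main: "K * y ^ k \<le> E k * (1 + y) ^ n" if "y > 0" for y
  proof -
    define t where "t = y / r"
    have t: "t > 0" "r * t = y" using that r by (auto simp: t_def)
    have "K * y ^ k = r ^ k * (K * t ^ k)" by (simp add: t(2)[symmetric] power_mult_distrib)
    also have "\<dots> \<le> r ^ k * (\<Sum>i\<le>n. (n choose i) * E i * t ^ i)"
      using lower[OF t(1)] r by (intro mult_left_mono) auto
    also have "\<dots> = (\<Sum>i\<le>n. (n choose i) * t ^ i * (E i * r ^ k))"
      by (simp add: sum_distrib_left mult_ac)
    also have "\<dots> \<le> (\<Sum>i\<le>n. (n choose i) * t ^ i * (E k * r ^ i))"
      using le t by (intro sum_mono mult_left_mono) auto
    also have "\<dots> = E k * (\<Sum>i\<le>n. (n choose i) * y ^ i)"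
      by (simp add: sum_distrib_left t(2)[symmetric] power_mult_distrib mult_ac)
    also have "(\<Sum>i\<le>n. (n choose i) * y ^ i) = (1 + y) ^ n"
      using binomial_ring[of y 1 n] by (simp add: add.commute)
    finally show ?thesis .
  qed
  show ?thesis
  proof (cases "k = n")
    case True
    \<comment> \<open>For \<open>k = n\<close> the infimum is only approached as \<open>y\<close>
      tends to infinity, so \<open>z = 1 / y\<close> is sent to \<open>0\<close>.\<close>
    have "K \<le> E k * (1 + z) ^ n" if "z > 0" for z
    proof -
      have "K * (1 / z) ^ n \<le> E k * (1 + 1 / z) ^ n" using main[of "1 / z"] that True by simp
      also have "1 + 1 / z = (1 + z) * (1 / z)" using that by (simp add: field_simps)
      finally show ?thesis using that by (simp add: power_divide field_simps)
    qed
    then have "eventually (\<lambda>z. K \<le> E k * (1 + z) ^ n) (at_right 0)"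
      by (auto simp: eventually_at_right_field intro: exI[of _ 1])
    moreover have "((\<lambda>z. E k * (1 + z) ^ n) \<longlongrightarrow> E k * (1 + 0) ^ n) (at_right 0)"
      by (intro tendsto_intros)
    ultimately have "K \<le> E k" using tendsto_lowerbound by force
    then show ?thesis using True n by simp
  next
    case False
    then have kn: "real k < n" using k by simp
    \<comment> \<open>The minimiser of \<open>(1 + y) ^ n / y ^ k\<close>.\<close>
    define y where "y = k / (real n - k)"
    have y: "y > 0" using k kn by (simp add: y_def)
    have 1: "1 + y = 1 / (1 - real k / n)" using kn n by (simp add: y_def field_simps)
    have 2: "y = (real k / n) / (1 - real k / n)" using kn n by (simp add: y_def field_simps)
    define c where "c = 1 - real k / n"
    have c: "c > 0" using kn n by (simp add: c_def)
    have "K * ((real k / n) / c) ^ k \<le> E k * (1 / c) ^ n"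
      using main[OF y] unfolding 1 2[symmetric] c_def[symmetric] by (simp add: 2 c_def)
    then have "K * (real k / n) ^ k * (c ^ n / c ^ k) \<le> E k"
      using c by (simp add: power_divide field_simps)
    also have "c ^ n / c ^ k = c ^ (n - k)" using c k by (simp add: power_diff)
    finally show ?thesis by (simp add: c_def)
  qed
qed

section \<open>Capacity\<close>

text \<open>Weighted inequality of the means for \<open>u / (1 - q)\<close> and
  \<open>v / q\<close>; the entropy collects the logarithms of the weights. It follows from two
  tangent bounds for \<open>ln\<close> whose right-hand sides cancel.\<close>

lemma ln_add_ge_Hent:
  fixes u v q :: real
  assumes "u > 0" "v > 0" "0 \<le> q" "q \<le> 1"
  shows "ln (u + v) \<ge> Hent q + (1 - q) * ln u + q * ln v"
proof (cases "q = 0 \<or> q = 1")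
  case True
  then show ?thesis using assms by (auto simp: Hent_def)
next
  case False
  then have q: "0 < q" "q < 1" using assms by auto
  define w where "w = u + v"
  have w: "w > 0" using assms by (simp add: w_def)
  have "ln u - ln (1 - q) - ln w = ln (u / ((1 - q) * w))"
    using assms q w by (simp add: ln_div ln_mult)
  also have "\<dots> \<le> u / ((1 - q) * w) - 1" using assms q w by (intro ln_le_minus_one) simp
  finally have "(1 - q) * (ln u - ln (1 - q) - ln w) \<le> (1 - q) * (u / ((1 - q) * w) - 1)"
    using q by (intro mult_left_mono) auto
  also have "\<dots> = u / w - (1 - q)" using q by (simp add: right_diff_distrib)
  finally have 1: "(1 - q) * (ln u - ln (1 - q) - ln w) \<le> u / w - (1 - q)" .
  have "ln v - ln q - ln w = ln (v / (q * w))"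
    using assms q w by (simp add: ln_div ln_mult)
  also have "\<dots> \<le> v / (q * w) - 1" using assms q w by (intro ln_le_minus_one) simp
  finally have "q * (ln v - ln q - ln w) \<le> q * (v / (q * w) - 1)"
    using q by (intro mult_left_mono) auto
  also have "\<dots> = v / w - q" using q by (simp add: field_simps)
  finally have 2: "q * (ln v - ln q - ln w) \<le> v / w - q" .
  have "u / w + v / w = 1" using w by (simp add: w_def add_divide_distrib[symmetric])
  with 1 2 have "(1 - q) * (ln u - ln (1 - q) - ln w) + q * (ln v - ln q - ln w) \<le> 0" by linarith
  then show ?thesis using False by (simp add: Hent_def w_def algebra_simps)
qed

lemma ln_sum_ge:
  fixes x :: "'a \<Rightarrow> real"
  assumes "finite S" "S \<noteq> {}" "\<And>j. j \<in> S \<Longrightarrow> x j > 0"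
  shows "ln (\<Sum>j\<in>S. x j) \<ge> ln (card S) + (\<Sum>j\<in>S. ln (x j)) / card S"
proof -
  define m where "m = (\<Sum>j\<in>S. x j) / card S"
  have c: "real (card S) > 0" using assms by (simp add: card_gt_0_iff)
  have s: "(\<Sum>j\<in>S. x j) > 0" using assms by (intro sum_pos) auto
  have m: "m > 0" using c s by (simp add: m_def)
  have "ln (x j) - ln m \<le> x j / m - 1" if "j \<in> S" for j
    using ln_le_minus_one[of "x j / m"] assms(3)[OF that] m by (simp add: ln_div)
  then have "(\<Sum>j\<in>S. ln (x j) - ln m) \<le> (\<Sum>j\<in>S. x j / m - 1)" by (rule sum_mono)
  also have "\<dots> = (\<Sum>j\<in>S. x j) / m - card S"
    by (simp add: sum_subtractf sum_divide_distrib[symmetric])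
  also have "\<dots> = 0" using c s by (simp add: m_def)
  finally have "(\<Sum>j\<in>S. ln (x j)) \<le> card S * ln m" by (simp add: sum_subtractf)
  then have "(\<Sum>j\<in>S. ln (x j)) / card S \<le> ln m" using c by (simp add: field_simps)
  also have "ln m = ln (\<Sum>j\<in>S. x j) - ln (card S)" using c s by (simp add: m_def ln_div)
  finally show ?thesis by simp
qed

lemma coeff_0_prod_mset_linear: "coeff (\<Prod>l\<in>#L. [:1, l:]) 0 = (1::'r::comm_semiring_1)"
  by (induction L) (auto simp: coeff_mult)

lemma coeff_1_prod_mset_linear:
  "coeff (\<Prod>l\<in>#L. [:1, l:]) 1 = (\<Sum>l\<in>#L. l :: 'r::comm_semiring_1)"
  by (induction L) (auto simp: coeff_mult coeff_0_prod_mset_linear add.commute simp del: mult_pCons_left)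

text \<open>Inequality of the means for the factors \<open>1 + s * l\<close> together with
  \<open>b - size L\<close> ones. The bound depends on \<open>L\<close> only through its sum, that
  is, through the linear coefficient.\<close>

lemma poly_prod_mset_linear_le:
  fixes s :: real
  assumes "\<forall>l\<in>#L. 0 < l" "size L \<le> b" "b > 0" "s > 0"
  shows "poly (\<Prod>l\<in>#L. [:1, l:]) s \<le> (1 + s * (\<Sum>l\<in>#L. l) / b) ^ b"
proof -
  define \<tau> where "\<tau> = 1 + s * (\<Sum>l\<in>#L. l) / b"
  have "(\<Sum>l\<in>#L. l) \<ge> 0" using assms(1) by (induction L) auto
  then have \<tau>: "\<tau> \<ge> 1" using assms by (simp add: \<tau>_def)
  \<comment> \<open>tangent form of the inequality of the means, around the mean \<open>\<tau>\<close> of the \<open>b\<close> factors padded with ones\<close>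
  have factor: "1 + s * l \<le> \<tau> * exp ((1 + s * l) / \<tau> - 1)" for l
    using exp_ge_add_one_self[of "(1 + s * l) / \<tau> - 1"] \<tau> by (simp add: field_simps)
  have nonneg: "poly (\<Prod>l\<in>#M. [:1, l:]) s \<ge> 0" if "\<forall>l\<in>#M. 0 < l" for M
    using that \<open>s > 0\<close> by (induction M) auto
  have "poly (\<Prod>l\<in>#L. [:1, l:]) s \<le> \<tau> ^ size L * exp ((size L + s * (\<Sum>l\<in>#L. l)) / \<tau> - size L)"
    using assms(1)
  proof (induction L)
    case (add l L)
    have "poly (\<Prod>l\<in>#add_mset l L. [:1, l:]) s = (1 + s * l) * poly (\<Prod>l\<in>#L. [:1, l:]) s"
      by (simp add: algebra_simps)
    also have "\<dots> \<le> (\<tau> * exp ((1 + s * l) / \<tau> - 1)) *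
        (\<tau> ^ size L * exp ((size L + s * (\<Sum>l\<in>#L. l)) / \<tau> - size L))"
      using add assms(4) \<tau> by (intro mult_mono' factor) (auto intro!: nonneg)
    also have "\<dots> = \<tau> ^ size (add_mset l L) *
        exp ((size (add_mset l L) + s * (\<Sum>l\<in>#add_mset l L. l)) / \<tau> - size (add_mset l L))"
      by (simp add: mult_exp_exp add_divide_distrib algebra_simps)
    finally show ?case .
  qed simp
  \<comment> \<open>The ones used as padding are the case \<open>l = 0\<close> of
    \<open>factor\<close>.\<close>
  also have "\<dots> \<le> \<tau> ^ size L * exp ((size L + s * (\<Sum>l\<in>#L. l)) / \<tau> - size L) *
      (\<tau> * exp (1 / \<tau> - 1)) ^ (b - size L)"
  proof -
    have "1 \<le> (\<tau> * exp (1 / \<tau> - 1)) ^ (b - size L)"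
      using factor[of 0] by (intro one_le_power) simp
    from mult_left_mono[OF this, of "\<tau> ^ size L * exp ((size L + s * (\<Sum>l\<in>#L. l)) / \<tau> - size L)"]
    show ?thesis using \<tau> by simp
  qed
  also have "\<dots> = \<tau> ^ b * exp ((b + s * (\<Sum>l\<in>#L. l)) / \<tau> - b)"
  proof -
    have "(\<tau> * exp (1 / \<tau> - 1)) ^ (b - size L)
        = \<tau> ^ (b - size L) * exp (real (b - size L) * (1 / \<tau> - 1))"
      by (simp add: power_mult_distrib exp_of_nat_mult)
    moreover have "\<tau> ^ size L * \<tau> ^ (b - size L) = \<tau> ^ b"
      using assms(2) by (simp flip: power_add)
    moreover have "exp ((size L + s * (\<Sum>l\<in>#L. l)) / \<tau> - size L) * exp (real (b - size L) * (1 / \<tau> - 1))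
        = exp ((b + s * (\<Sum>l\<in>#L. l)) / \<tau> - b)"
      using assms(2) \<tau> by (simp add: mult_exp_exp of_nat_diff field_simps)
    ultimately show ?thesis by (simp add: mult_ac)
  qed
  also have "(b + s * (\<Sum>l\<in>#L. l)) / \<tau> - b = 0"
  proof -
    have "b * \<tau> = b + s * (\<Sum>l\<in>#L. l)" using assms(3) by (simp add: \<tau>_def field_simps)
    then show ?thesis using \<tau> by (simp add: field_simps)
  qed
  finally show ?thesis by (simp add: \<tau>_def)
qed

text \<open>
Dropping the terms of degree at least two from \<open>c * (\<Prod>l\<in>#L. [:1, l:])\<close> leaves \<open>c * (1 + t * (\<Sum>l\<in>#L. l))\<close>.
\<close>

lemma truncation_capacity:
  fixes g \<theta> c t :: real
  assumes L: "\<forall>l\<in>#L. 0 < l" "size L \<le> b" "b > 0" and c: "c > 0" and \<theta>: "0 < \<theta>" "\<theta> \<le> 1"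
    and lower: "\<And>s. s > 0 \<Longrightarrow> ln (c * poly (\<Prod>l\<in>#L. [:1, l:]) s) \<ge> g + \<theta> * ln s"
    and t: "t > 0"
  shows "ln (c * (1 + t * (\<Sum>l\<in>#L. l))) \<ge> g + \<theta> * ln t + (Hent \<theta> + \<theta> * ln b - b * Hent (\<theta> / b))"
proof (cases "b = 1")
  \<comment> \<open>For \<open>b = 1\<close> there is nothing to drop and the gain is
    \<open>0\<close>. The choice of \<open>s\<close> below would divide by zero if also
    \<open>\<theta> = 1\<close>.\<close>
  case True
  then consider "L = {#}" | l where "L = {#l#}"
    using L(2) by (cases L) auto
  then have "poly (\<Prod>l\<in>#L. [:1, l:]) t = 1 + t * (\<Sum>l\<in>#L. l)"
    by cases auto
  then show ?thesis using lower[OF t] True by simp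
next
  case False
  then have b: "b > \<theta>" "b > 0" using L \<theta> by auto
  define r where "r = (\<Sum>l\<in>#L. l)"
  have ub: "ln (c * poly (\<Prod>l\<in>#L. [:1, l:]) s) \<le> ln c + b * ln (1 + s * r / b)" if "s > 0" for s
  proof -
    have r0: "r \<ge> 0" unfolding r_def using L(1) by (induction L) auto
    have p0: "poly (\<Prod>l\<in>#L. [:1, l:]) s > 0"
      using L(1) that by (induction L) (auto intro!: mult_pos_pos add_pos_pos simp del: mult_pCons_left)
    have "ln (c * poly (\<Prod>l\<in>#L. [:1, l:]) s) \<le> ln (c * (1 + s * r / b) ^ b)"
      using poly_prod_mset_linear_le[OF L that] c p0 by (simp add: r_def)
    also have "\<dots> = ln c + b * ln (1 + s * r / b)"
    proof -
      have "1 + s * r / b > 0" using r0 that by (intro add_pos_nonneg) auto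
      then show ?thesis using c by (simp add: ln_mult ln_realpow)
    qed
    finally show ?thesis .
  qed
  \<comment> \<open>With \<open>r = 0\<close> the upper bound would be constant in \<open>s\<close>,
    while the lower bound grows without limit.\<close>
  have "r \<noteq> 0"
  proof
    assume "r = 0"
    then have "g + \<theta> * ln s \<le> ln c" if "s > 0" for s
      using ub[OF that] lower[OF that] by simp
    from this[of "exp ((ln c - g + 1) / \<theta>)"] show False using \<theta> by simp
  qed
  moreover have "r \<ge> 0" unfolding r_def using L(1) by (induction L) auto
  ultimately have r: "r > 0" by simp
  \<comment> \<open>The minimiser of \<open>b * ln (1 + s * r / b) - \<theta> * ln s\<close>, which
    gives the best lower bound for \<open>ln c\<close> in terms of \<open>r\<close>.\<close>
  define s where "s = \<theta> * b / (r * (b - \<theta>))"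
  have s: "s > 0" using r \<theta> b by (simp add: s_def)
  have lns: "ln s = ln \<theta> + ln b - ln r - ln (b - \<theta>)"
    using r \<theta> b by (simp add: s_def ln_div ln_mult)
  have "1 + s * r / b = b / (b - \<theta>)" using r b by (simp add: s_def field_simps)
  then have "ln (1 + s * r / b) = ln b - ln (b - \<theta>)" using b by (simp add: ln_div)
  then have 1: "ln c \<ge> g + \<theta> * (ln \<theta> + ln b - ln r - ln (b - \<theta>)) - b * (ln b - ln (b - \<theta>))"
    using ub[OF s] lower[OF s] lns by simp
  \<comment> \<open>Weight \<open>\<theta>\<close> is chosen so that the unknown \<open>ln r\<close>
    cancels against the bound for \<open>ln c\<close>.\<close>
  have 2: "ln (1 + t * r) \<ge> Hent \<theta> + \<theta> * (ln t + ln r)"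
    using ln_add_ge_Hent[of 1 "t * r" \<theta>] r t \<theta> by (simp add: ln_mult)
  have 3: "b * Hent (\<theta> / b) = - (\<theta> * (ln \<theta> - ln b) + (b - \<theta>) * (ln (b - \<theta>) - ln b))"
  proof -
    have "1 - \<theta> / b = (b - \<theta>) / b" using b by (simp add: field_simps)
    then show ?thesis using b \<theta> by (simp add: Hent_def ln_div field_simps)
  qed
  have "ln (c * (1 + t * r)) = ln c + ln (1 + t * r)"
  proof -
    have "1 + t * r > 0" using r t by (simp add: add_pos_pos)
    then show ?thesis using c by (simp add: ln_mult)
  qed
  then show ?thesis unfolding r_def[symmetric] 3 using 1 2 by (simp add: algebra_simps)
qed

text \<open>Each list entry costs one truncation. \<open>W F x u\<close> is the total weight of the
  choices of \<open>u\<close> when vertices of \<open>F\<close> may still be chosen repeatedly;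
  moving \<open>j\<close> into the list keeps only the constant and linear terms in
  \<open>x j\<close>.\<close>

lemma capacity_bound:
  fixes N :: "'b \<Rightarrow> 'a set" and g \<theta> :: real
  defines "W \<equiv> \<lambda>F x u. 1 + (\<Sum>j\<in>F. of_bool (u \<in> N j) * x j :: real)"
  assumes "finite A" "finite B" "0 < b" "0 < \<theta>" "\<theta> \<le> 1"
    and deg: "\<And>j. j \<in> B \<Longrightarrow> card (A \<inter> N j) = b"
    and base: "\<And>x. (\<And>j. x j > 0) \<Longrightarrow> ln (\<Prod>u\<in>A. W B x u) \<ge> g + \<theta> * (\<Sum>j\<in>B. ln (x j))"
    and "distinct ts" "set ts \<subseteq> B" "\<And>j. x j > 0"
  shows "ln (matching_sum N x (W (B - set ts) x) ts A)
    \<ge> g + \<theta> * (\<Sum>j\<in>B. ln (x j)) + length ts * (Hent \<theta> + \<theta> * ln b - b * Hent (\<theta> / b))"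
  using assms(9-11)
proof (induction ts arbitrary: x)
  case Nil
  then show ?case using base by simp
next
  case (Cons j ts)
  define F where "F = B - set (j # ts)"
  define d where "d = W F x"
  define e where "e = (\<lambda>u. of_bool (u \<in> N j) :: real)"
  let ?H = "Hent \<theta> + \<theta> * ln b - b * Hent (\<theta> / b)"
  define G where "G = g + \<theta> * (\<Sum>i\<in>B - {j}. ln (x i)) + length ts * ?H"
  have jB: "j \<in> B" "j \<notin> set ts" using Cons.prems by auto
  have d: "d u > 0" for u
    unfolding d_def W_def using Cons.prems(3) by (intro add_pos_nonneg sum_nonneg) (auto simp: less_imp_le)
  \<comment> \<open>The sum before the truncation at \<open>j\<close>, as a polynomial in
    \<open>x j\<close> with the other variables fixed. Only the \<open>b\<close> neighbours of
    \<open>j\<close> involve the variable, so the degree is at most \<open>b\<close>.\<close>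
  define P where "P = matching_sum N (\<lambda>j. [:x j:]) (\<lambda>u. [:d u, e u:]) ts A"
  have c0: "coeff P 0 = matching_sum N x d ts A" unfolding P_def by (rule matching_sum_coeff_0)
  have pos: "coeff P 0 > 0" unfolding c0 using assms Cons.prems d by (intro matching_sum_pos) auto
  have "\<exists>L. (\<forall>l\<in>#L. 0 < l) \<and> size L = degree P \<and> P = smult (coeff P 0) (\<Prod>l\<in>#L. [:1, l:])"
  proof (rule real_rooted_factor)
    show "z \<in> \<real> \<and> Re z \<le> 0" if "poly (map_poly of_real P) z = 0" for z :: complex
      using that d Cons.prems(3) unfolding P_def
      by (intro matching_sum_real_rooted[of A ts x "\<lambda>_. 0" d e N z] \<open>finite A\<close>)
        (auto simp: e_def less_imp_le add_pos_nonneg)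
  qed (use pos in simp)
  then obtain L where L: "\<forall>l\<in>#L. 0 < l" "size L = degree P" "P = smult (coeff P 0) (\<Prod>l\<in>#L. [:1, l:])"
    by blast
  have "degree P \<le> (\<Sum>u\<in>A. of_bool (u \<in> N j))"
    unfolding P_def by (intro matching_sum_degree \<open>finite A\<close>) (auto simp: e_def)
  also have "\<dots> = b" using deg[OF jB(1)] \<open>finite A\<close> by (simp add: of_bool_def sum.If_cases Int_def)
  finally have size: "size L \<le> b" using L by simp
  have c1: "coeff P 0 * (\<Sum>l\<in>#L. l) = (\<Sum>u\<in>A \<inter> N j. matching_sum N x d ts (A - {u}))"
  proof -
    have "coeff P 1 = coeff P 0 * (\<Sum>l\<in>#L. l)"
      by (subst L(3)) (simp only: coeff_smult coeff_1_prod_mset_linear)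
    moreover have "coeff P 1 = (\<Sum>u\<in>A. e u * matching_sum N x d ts (A - {u}))"
      unfolding P_def by (rule matching_sum_coeff_1) fact
    moreover have "\<dots> = (\<Sum>u\<in>A \<inter> N j. matching_sum N x d ts (A - {u}))"
      using \<open>finite A\<close> by (simp add: e_def of_bool_def if_distrib[of "\<lambda>c. c * _"] sum.If_cases Int_def cong: if_cong)
    ultimately show ?thesis by simp
  qed
  \<comment> \<open>The induction hypothesis must hold for every positive \<open>x\<close>: it is
    used here at \<open>x(j := s)\<close> for all \<open>s\<close>.\<close>
  have lower: "ln (coeff P 0 * poly (\<Prod>l\<in>#L. [:1, l:]) s) \<ge> G + \<theta> * ln s" if s: "s > 0" for s
  proof -
    let ?x = "x(j := s)"
    have "coeff P 0 * poly (\<Prod>l\<in>#L. [:1, l:]) s = poly P s" by (subst (2) L(3)) simp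
    also have "poly P s = matching_sum N x (\<lambda>u. d u + e u * s) ts A"
      unfolding P_def by (subst matching_sum_hom[of "\<lambda>p. poly p s"]) (simp_all add: mult.commute)
    also have "\<dots> = matching_sum N ?x (W (B - set ts) ?x) ts A"
    proof (rule matching_sum_cong)
      fix u
      have "B - set ts = insert j F" "j \<notin> F" "finite F" using jB assms(3) by (auto simp: F_def)
      then show "d u + e u * s = W (B - set ts) ?x u"
        by (simp add: d_def W_def e_def) (intro sum.cong, auto)
    qed (use jB in auto)
    finally have eq: "coeff P 0 * poly (\<Prod>l\<in>#L. [:1, l:]) s = matching_sum N ?x (W (B - set ts) ?x) ts A" .
    have "g + \<theta> * (\<Sum>i\<in>B. ln (?x i)) + length ts * ?H \<le> ln (matching_sum N ?x (W (B - set ts) ?x) ts A)"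
      using Cons.prems s by (intro Cons.IH) auto
    moreover have "(\<Sum>i\<in>B. ln (?x i)) = ln s + (\<Sum>i\<in>B - {j}. ln (x i))"
      using jB assms(3) by (subst sum.remove[of B j]) (auto intro!: sum.cong)
    ultimately show ?thesis unfolding eq by (simp add: G_def algebra_simps)
  qed
  have "ln (coeff P 0 * (1 + x j * (\<Sum>l\<in>#L. l))) \<ge> G + \<theta> * ln (x j) + ?H"
    using L(1) size \<open>0 < b\<close> pos \<open>0 < \<theta>\<close> \<open>\<theta> \<le> 1\<close> lower Cons.prems(3)[of j] by (rule truncation_capacity)
  also have "coeff P 0 * (1 + x j * (\<Sum>l\<in>#L. l)) = coeff P 0 + x j * (coeff P 0 * (\<Sum>l\<in>#L. l))"
    by (simp add: algebra_simps)
  also have "\<dots> = matching_sum N x d (j # ts) A" unfolding c1 by (simp add: c0)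
  finally have "G + \<theta> * ln (x j) + ?H \<le> ln (matching_sum N x (W (B - set (j # ts)) x) (j # ts) A)"
    by (simp only: d_def F_def)
  moreover have "(\<Sum>i\<in>B. ln (x i)) = ln (x j) + (\<Sum>i\<in>B - {j}. ln (x i))"
    using jB assms(3) by (intro sum.remove)
  ultimately show ?case by (simp add: G_def algebra_simps del: matching_sum.simps set_simps)
qed

section \<open>Counting matchings\<close>

lemma matchings_0: "finite E \<Longrightarrow> matchings E 0 = {{}}"
  by (auto simp: matchings_def dest: finite_subset)

lemma finite_matchings: "finite E \<Longrightarrow> finite (matchings E k)"
  by (rule finite_subset[of _ "Pow E"]) (auto simp: matchings_def)

text \<open>Matchings are sorted by the partner of \<open>j\<close>, if any; deleting its edge
  leaves a matching that avoids both ends. This is the recursion of \<open>matching_sum\<close> for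
  cardinalities.\<close>

lemma card_matchings_vertex:
  fixes N :: "'v \<Rightarrow> 'v set"
  assumes "finite U" "finite T" "j \<notin> T"
  defines "F \<equiv> \<lambda>U T. {(u, i). i \<in> T \<and> u \<in> U \<and> u \<in> N i}"
  shows "card (matchings (F U (insert j T)) (Suc k))
    = card (matchings (F U T) (Suc k)) + (\<Sum>u\<in>U \<inter> N j. card (matchings (F (U - {u}) T) k))"
proof -
  have finF: "finite (F V T)" if "finite V" for V
    by (rule finite_subset[of _ "V \<times> T"]) (use assms that in \<open>auto simp: F_def\<close>)
  let ?I = "\<lambda>u. insert (u, j) ` matchings (F (U - {u}) T) k"
  have j: "(u, j) \<notin> M" if "M \<in> matchings (F V T) l" for u V l M
    using that assms(3) by (auto simp: matchings_def F_def)
  have "matchings (F U (insert j T)) (Suc k) = matchings (F U T) (Suc k) \<union> (\<Union>u\<in>U \<inter> N j. ?I u)"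
    (is "?L = ?R")
  proof (intro equalityI subsetI)
    fix M assume M: "M \<in> ?L"
    show "M \<in> ?R"
    proof (cases "\<exists>u. (u, j) \<in> M")
      case False
      then have "M \<in> matchings (F U T) (Suc k)" using M by (auto simp: matchings_def F_def)
      then show ?thesis by simp
    next
      case True
      then obtain u where u: "(u, j) \<in> M" by blast
      have MF: "M \<subseteq> F U (insert j T)" and cM: "card M = Suc k"
        and dis: "\<And>e e'. e \<in> M \<Longrightarrow> e' \<in> M \<Longrightarrow> e \<noteq> e' \<Longrightarrow> fst e \<noteq> fst e' \<and> snd e \<noteq> snd e'"
        using M by (auto simp: matchings_def)
      have uU: "u \<in> U \<inter> N j" using u MF by (auto simp: F_def)
      have "M - {(u, j)} \<subseteq> F (U - {u}) T"
      proof
        fix e assume e: "e \<in> M - {(u, j)}"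
        then have "fst e \<noteq> u" "snd e \<noteq> j" using dis[of e "(u, j)"] u by auto
        then show "e \<in> F (U - {u}) T" using e MF by (auto simp: F_def)
      qed
      moreover have "card (M - {(u, j)}) = k" using cM u by simp
      ultimately have "M - {(u, j)} \<in> matchings (F (U - {u}) T) k"
        using dis by (auto simp: matchings_def)
      then have "insert (u, j) (M - {(u, j)}) \<in> ?I u" by (rule imageI)
      then show ?thesis using u uU by (auto simp: insert_absorb)
    qed
  next
    fix M assume "M \<in> ?R"
    then consider "M \<in> matchings (F U T) (Suc k)"
      | u M' where "u \<in> U \<inter> N j" "M' \<in> matchings (F (U - {u}) T) k" "M = insert (u, j) M'"
      by blast
    then show "M \<in> ?L"
    proof cases
      case 1
      then show ?thesis by (auto simp: matchings_def F_def)
    next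
      case 2
      then have "finite M'" using finF[of "U - {u}"] assms(1)
        by (auto simp: matchings_def dest: finite_subset)
      then have c: "card M = Suc k" using 2 j[OF 2(2)] by (simp add: matchings_def)
      have M': "M' \<subseteq> F (U - {u}) T" using 2 by (simp add: matchings_def)
      have new: "fst e \<noteq> u \<and> snd e \<noteq> j" if "e \<in> M'" for e
        using M' that assms(3) by (auto simp: F_def)
      show ?thesis unfolding matchings_def
      proof (intro CollectI conjI ballI impI)
        show "M \<subseteq> F U (insert j T)" using 2 M' by (auto simp: F_def)
        show "card M = Suc k" by (rule c)
        fix e e' assume "e \<in> M" "e' \<in> M" "e \<noteq> e'"
        then have "(e = (u, j) \<and> e' \<in> M') \<or> (e' = (u, j) \<and> e \<in> M') \<or> (e \<in> M' \<and> e' \<in> M')"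
          using 2 by auto
        then show "fst e \<noteq> fst e'" "snd e \<noteq> snd e'"
          using new[of e] new[of e'] 2(2) \<open>e \<noteq> e'\<close> by (auto simp: matchings_def)
      qed
    qed
  qed
  moreover have "card (matchings (F U T) (Suc k) \<union> (\<Union>u\<in>U \<inter> N j. ?I u))
      = card (matchings (F U T) (Suc k)) + card (\<Union>u\<in>U \<inter> N j. ?I u)"
  proof (rule card_Un_disjoint)
    have "insert (u, j) M \<notin> matchings (F U T) (Suc k)" for u M
      using j by (metis insertI1)
    then show "matchings (F U T) (Suc k) \<inter> (\<Union>u\<in>U \<inter> N j. ?I u) = {}" by blast
  qed (use assms(1) finF in \<open>auto intro!: finite_matchings\<close>)
  moreover have "card (\<Union>u\<in>U \<inter> N j. ?I u) = (\<Sum>u\<in>U \<inter> N j. card (?I u))"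
  proof (intro card_UN_disjoint ballI impI)
    fix u w :: 'v
    assume "u \<noteq> w"
    show "?I u \<inter> ?I w = {}"
    proof (rule ccontr)
      assume "?I u \<inter> ?I w \<noteq> {}"
      then obtain M M' where *: "M \<in> matchings (F (U - {u}) T) k" "M' \<in> matchings (F (U - {w}) T) k"
        "insert (u, j) M = insert (w, j) M'" by blast
      then have "(u, j) \<in> insert (w, j) M'" by blast
      then show False using \<open>u \<noteq> w\<close> j[OF *(2)] by auto
    qed
  qed (use assms(1) finF in \<open>auto intro!: finite_matchings\<close>)
  moreover have "card (?I u) = card (matchings (F (U - {u}) T) k)" for u
    by (intro card_image inj_onI) (use j insert_ident in metis)
  ultimately show ?thesis by simp
qed

text \<open>Unmatched vertices weigh \<open>1\<close> and each matched pair brings one power of the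
  variable, so the exponent counts edges.\<close>

lemma coeff_matching_sum_matchings:
  fixes N :: "'v \<Rightarrow> 'v set"
  assumes "finite U" "distinct ts"
  shows "coeff (matching_sum N (\<lambda>_. [:0, 1:]) (\<lambda>_. 1) ts U) k
    = real (card (matchings {(u, i). i \<in> set ts \<and> u \<in> U \<and> u \<in> N i} k))"
  using assms
proof (induction ts arbitrary: U k)
  case Nil
  have "matchings ({} :: ('v \<times> 'v) set) k = (if k = 0 then {{}} else {})"
    by (auto simp: matchings_def)
  moreover have "coeff (1 :: real poly) k = (if k = 0 then 1 else 0)"
    by (simp add: one_pCons coeff_pCons split: nat.split)
  ultimately show ?case by simp
next
  case (Cons j ts)
  show ?case
  proof (cases k)
    case 0
    have "finite {(u, i). i \<in> set T \<and> u \<in> U \<and> u \<in> N i}" for T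
      by (rule finite_subset[of _ "U \<times> set T"]) (use Cons.prems in auto)
    then show ?thesis using Cons.IH[of U 0] Cons.prems 0 by (simp add: matchings_0 del: set_simps)
  next
    case (Suc k)
    show ?thesis using Cons Suc card_matchings_vertex[of U "set ts" j N k]
      by (simp add: coeff_sum)
  qed
qed

section \<open>From the capacity bound to the number of matchings\<close>

text \<open>Each factor is bounded by the two inequalities of the means: weight \<open>q\<close> on
  choosing a neighbour, then equal weights on the \<open>a\<close> neighbours. Summing over
  \<open>A\<close> collects every \<open>ln (x j)\<close> once per edge at \<open>j\<close>, that
  is, \<open>b\<close> times.\<close>

lemma base_capacity:
  fixes N :: "'b \<Rightarrow> 'a set" and x :: "'b \<Rightarrow> real"
  assumes "finite A" "finite B" "0 < a" "0 \<le> q" "q \<le> 1"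
    and degA: "\<And>u. u \<in> A \<Longrightarrow> card {j \<in> B. u \<in> N j} = a"
    and degB: "\<And>j. j \<in> B \<Longrightarrow> card (A \<inter> N j) = b"
    and x: "\<And>j. x j > 0"
  shows "ln (\<Prod>u\<in>A. 1 + (\<Sum>j\<in>B. of_bool (u \<in> N j) * x j))
    \<ge> card A * (Hent q + q * ln a) + q * b / a * (\<Sum>j\<in>B. ln (x j))"
proof -
  define l where "l = (\<lambda>u. \<Sum>j\<in>B. of_bool (u \<in> N j) * x j)"
  have l: "l u = (\<Sum>j | j \<in> B \<and> u \<in> N j. x j)" for u
    unfolding l_def using \<open>finite B\<close>
    by (simp add: of_bool_def if_distrib[of "\<lambda>c. c * _"] sum.If_cases Int_def cong: if_cong)
  have local: "ln (1 + l u) \<ge> Hent q + q * ln a + q / a * (\<Sum>j | j \<in> B \<and> u \<in> N j. ln (x j))"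
    if u: "u \<in> A" for u
  proof -
    have ne: "{j \<in> B. u \<in> N j} \<noteq> {}" using degA[OF u] \<open>0 < a\<close> by fastforce
    have "l u > 0" unfolding l using ne \<open>finite B\<close> x by (intro sum_pos) auto
    then have "ln (1 + l u) \<ge> Hent q + q * ln (l u)"
      using ln_add_ge_Hent[of 1 "l u" q] assms by simp
    moreover have "ln (l u) \<ge> ln a + (\<Sum>j | j \<in> B \<and> u \<in> N j. ln (x j)) / a"
      unfolding l using ln_sum_ge[of "{j \<in> B. u \<in> N j}" x] ne \<open>finite B\<close> x degA[OF u] by simp
    then have "q * ln (l u) \<ge> q * (ln a + (\<Sum>j | j \<in> B \<and> u \<in> N j. ln (x j)) / a)"
      using \<open>0 \<le> q\<close> by (rule mult_left_mono)
    ultimately show ?thesis by (simp add: distrib_left)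
  qed
  have "(\<Sum>u\<in>A. \<Sum>j | j \<in> B \<and> u \<in> N j. ln (x j)) = (\<Sum>j\<in>B. \<Sum>u | u \<in> A \<and> u \<in> N j. ln (x j))"
    using assms by (intro sum.swap_restrict)
  also have "\<dots> = (\<Sum>j\<in>B. b * ln (x j))"
    using degB by (intro sum.cong) (auto simp: Int_def)
  finally have swap: "(\<Sum>u\<in>A. \<Sum>j | j \<in> B \<and> u \<in> N j. ln (x j)) = b * (\<Sum>j\<in>B. ln (x j))"
    by (simp add: sum_distrib_left)
  have pos: "1 + l u > 0" for u
    unfolding l using x by (intro add_pos_nonneg sum_nonneg) (auto simp: less_imp_le)
  have "card A * (Hent q + q * ln a) + q * b / a * (\<Sum>j\<in>B. ln (x j))
      = (\<Sum>u\<in>A. Hent q + q * ln a + q / a * (\<Sum>j | j \<in> B \<and> u \<in> N j. ln (x j)))"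
    by (simp add: sum.distrib sum_distrib_left[symmetric] sum_divide_distrib[symmetric] swap)
  also have "\<dots> \<le> (\<Sum>u\<in>A. ln (1 + l u))" using local by (rule sum_mono)
  also have "\<dots> = ln (\<Prod>u\<in>A. 1 + l u)"
    using pos \<open>finite A\<close> by (subst ln_prod) (auto simp: less_imp_neq[symmetric])
  finally show ?thesis by (simp add: l_def)
qed

lemma matchings_lower_bound:
  fixes N :: "'v \<Rightarrow> 'v set" and g :: real
  assumes "finite A" "finite B" "0 < k" "k \<le> card A"
    and lower: "\<And>t ts. t > 0 \<Longrightarrow> distinct ts \<Longrightarrow> set ts = B \<Longrightarrow> ln (matching_sum N (\<lambda>_. t) (\<lambda>_. 1) ts A) \<ge> g + k * ln t"
  defines "n \<equiv> card A"
  shows "real (card (matchings {(u, i). i \<in> B \<and> u \<in> A \<and> u \<in> N i} k))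
    \<ge> (n choose k) * (exp g * (real k / n) ^ k * (1 - real k / n) ^ (n - k))"
proof -
  obtain ts where ts: "set ts = B" "distinct ts" using finite_distinct_list[OF \<open>finite B\<close>] by blast
  \<comment> \<open>\<open>[:1, 0:]\<close> is the constant \<open>1\<close>, written in the linear
    shape of \<open>matching_sum_real_rooted\<close>.\<close>
  define P :: "real poly" where "P = matching_sum N (\<lambda>_. [:0, 1:]) (\<lambda>_. [:1, 0:]) ts A"
  have evalP: "poly P t = matching_sum N (\<lambda>_. t) (\<lambda>_. 1) ts A" for t
    unfolding P_def by (subst matching_sum_hom[of "\<lambda>p. poly p t"]) simp_all
  have coeffP: "coeff P i = card (matchings {(u, i). i \<in> B \<and> u \<in> A \<and> u \<in> N i} i)" for i
    using coeff_matching_sum_matchings[OF \<open>finite A\<close> ts(2), of N i] by (simp add: P_def ts one_pCons)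
  have fin: "finite {(u, i). i \<in> B \<and> u \<in> A \<and> u \<in> N i}"
    by (rule finite_subset[of _ "A \<times> B"]) (use assms in auto)
  have c0: "coeff P 0 = 1" using fin by (simp add: coeffP matchings_0)
  have "\<exists>L. (\<forall>l\<in>#L. 0 < l) \<and> size L = degree P \<and> P = smult (coeff P 0) (\<Prod>l\<in>#L. [:1, l:])"
  proof (rule real_rooted_factor)
    show "z \<in> \<real> \<and> Re z \<le> 0" if "poly (map_poly of_real P) z = 0" for z :: complex
      using that unfolding P_def
      by (intro matching_sum_real_rooted[of A ts "\<lambda>_. 0" "\<lambda>_. 1" "\<lambda>_. 1" "\<lambda>_. 0" N z] \<open>finite A\<close>) auto
  qed (simp add: c0)
  then obtain L where L: "\<forall>l\<in>#L. 0 < l" "size L = degree P" "P = (\<Prod>l\<in>#L. [:1, l:])"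
    by (auto simp: c0)
  have "degree P \<le> (\<Sum>u\<in>A. 1)" unfolding P_def by (intro matching_sum_degree \<open>finite A\<close>) auto
  then have size: "size L \<le> n" using L by (simp add: n_def)
  \<comment> \<open>The factors for \<open>0\<close> equal \<open>1\<close>. They normalise the
    coefficients by \<open>n choose i\<close> with \<open>n = card A\<close>, whatever the degree of
    \<open>P\<close> is.\<close>
  let ?L = "L + replicate_mset (n - size L) 0"
  have P: "P = (\<Prod>l\<in>#?L. [:1, l:])" by (subst L(3)) (simp add: one_pCons[symmetric])
  have "\<forall>l\<in>#?L. l \<ge> 0" using L(1) by (auto simp: less_imp_le)
  from newton_inequalities[OF this] obtain E :: "nat \<Rightarrow> real"
    where E: "ultra_log_concave n E" "\<And>i. coeff P i = (n choose i) * E i"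
    using size unfolding P[symmetric] by auto
  have "exp g * t ^ k \<le> (\<Sum>i\<le>n. (n choose i) * E i * t ^ i)" if t: "t > 0" for t
  proof -
    have "matching_sum N (\<lambda>_. t) (\<lambda>_. 1) ts A > 0" using t by (intro matching_sum_pos \<open>finite A\<close>) auto
    then have "exp (g + k * ln t) \<le> poly P t"
      using lower[OF t ts(2,1)] unfolding evalP by (metis exp_le_cancel_iff exp_ln)
    also have "poly P t = (\<Sum>i\<le>n. (n choose i) * E i * t ^ i)"
      unfolding poly_altdef E(2)[symmetric] using size L(2)
      by (intro sum.mono_neutral_left) (auto simp: coeff_eq_0)
    finally show ?thesis using t by (simp add: exp_add exp_of_nat_mult)
  qed
  from ultra_log_concave_coeff_ge[OF E(1) \<open>0 < k\<close> _ _ this]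
  have "exp g * (real k / n) ^ k * (1 - real k / n) ^ (n - k) \<le> E k"
    using assms by (simp add: n_def)
  then show ?thesis unfolding coeffP[symmetric] E(2) by (intro mult_left_mono) auto
qed

theorem theorem1p7:
  fixes a b k :: nat and A B :: "'v set" and E :: "('v \<times> 'v) set"
  assumes "b > 0" and "a \<ge> b"
    and "biregular a b A B E"
    and "k \<le> card A"
  shows "let v = real (card A + card B);
             p = 2 * real k / v;
             q = (real a + real b) / (2 * real b) * p;
             p_mu = real (card A choose k) * q ^ k * (1 - q) ^ (card A - k)
         in real (card (matchings E k)) \<ge> p_mu * exp (v * Gfun a b p)"
proof (cases "k = 0")
  \<comment> \<open>Both sides are \<open>1\<close>. The case is separate because the truncation
    needs \<open>\<theta> > 0\<close>.\<close>
  case True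
  have "finite E" using assms(3) by (auto simp: biregular_def bipartite_graph_def intro: finite_subset)
  then show ?thesis using True by (simp add: matchings_0 Let_def Gfun_def Hent_def)
next
  case False
  then have k: "0 < k" by simp
  define N where "N = (\<lambda>j. {x. (x, j) \<in> E})"
  define n m where "n = card A" and "m = card B"
  have fin: "finite A" "finite B" and EAB: "E \<subseteq> A \<times> B"
    and dA: "\<And>u. u \<in> A \<Longrightarrow> card {y. (u, y) \<in> E} = a" and dB: "\<And>j. j \<in> B \<Longrightarrow> card {x. (x, j) \<in> E} = b"
    using assms(3) by (auto simp: biregular_def bipartite_graph_def)
  have "{j \<in> B. u \<in> N j} = {y. (u, y) \<in> E}" for u using EAB by (auto simp: N_def)
  then have degA: "card {j \<in> B. u \<in> N j} = a" if "u \<in> A" for u using dA[OF that] by simp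
  have "A \<inter> N j = {x. (x, j) \<in> E}" for j using EAB by (auto simp: N_def)
  then have degB: "card (A \<inter> N j) = b" if "j \<in> B" for j using dB[OF that] by simp
  have E: "E = {(u, i). i \<in> B \<and> u \<in> A \<and> u \<in> N i}" using EAB by (auto simp: N_def)
  have "n * a = (\<Sum>u\<in>A. card {j \<in> B. u \<in> N j})" using degA by (simp add: n_def)
  also have "\<dots> = (\<Sum>j\<in>B. card {u \<in> A. u \<in> N j})" 
    using sum.swap_restrict[of A B "\<lambda>_ _. 1 :: nat" "\<lambda>u j. u \<in> N j"] fin by simp
  also have "\<dots> = m * b" using degB by (simp add: m_def Int_def)
  finally have edges: "n * a = m * b" .
  have pos: "0 < n" "0 < a" "0 < m"
    using k assms(1,2,4) edges by (auto simp: n_def intro!: Nat.gr0I)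
  have nm: "n \<le> m"
  proof -
    have "n * b \<le> m * b" using edges assms(2) by (metis mult_le_mono2)
    then show ?thesis using assms(1) by simp
  qed
  \<comment> \<open>\<open>q\<close> and \<open>\<theta>\<close> are the fractions of
    \<open>A\<close> and of \<open>B\<close> that a matching of size \<open>k\<close> covers.
    Counting edges from both sides relates them by \<open>q * b / a = \<theta>\<close>.\<close>
  define q where "q = real k / n"
  define \<theta> where "\<theta> = real k / m"
  have q: "0 < q" "q \<le> 1" using k pos assms(4) by (auto simp: q_def n_def)
  have \<theta>: "0 < \<theta>" "\<theta> \<le> 1" using k pos nm assms(4) by (auto simp: \<theta>_def n_def)
  have edges': "real n * a = real m * b" using edges by (metis of_nat_mult)
  have q\<theta>: "q * b / a = \<theta>"
    using edges' pos assms(1) by (simp add: q_def \<theta>_def field_simps)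
  \<comment> \<open>The constant before any truncation, plus the gain of \<open>m\<close>
    truncations.\<close>
  define g where "g = n * (Hent q + q * ln a) + m * (Hent \<theta> + \<theta> * ln b - b * Hent (\<theta> / b))"
  have lower: "ln (matching_sum N (\<lambda>_. t) (\<lambda>_. 1) ts A) \<ge> g + k * ln t"
    if t: "t > 0" and ts: "distinct ts" "set ts = B" for t ts
  proof -
    have "ln (matching_sum N (\<lambda>_. t) (\<lambda>u. 1 + (\<Sum>j\<in>B - set ts. of_bool (u \<in> N j) * t)) ts A)
        \<ge> n * (Hent q + q * ln a) + \<theta> * (\<Sum>j\<in>B. ln t)
          + length ts * (Hent \<theta> + \<theta> * ln b - b * Hent (\<theta> / b))"
    proof (rule capacity_bound)
      show "n * (Hent q + q * ln a) + \<theta> * (\<Sum>j\<in>B. ln (x j))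
          \<le> ln (\<Prod>u\<in>A. 1 + (\<Sum>j\<in>B. of_bool (u \<in> N j) * x j))" if "\<And>j. x j > 0" for x
        using base_capacity[of A B a q N b x] fin pos q degA degB that by (simp add: q\<theta> n_def)
    qed (use fin assms(1) \<theta> degB t ts in auto)
    moreover have "length ts = m" using distinct_card[OF ts(1)] ts by (simp add: m_def)
    moreover have "\<theta> * (\<Sum>j\<in>B. ln t) = k * ln t"
      using pos by (simp add: \<theta>_def flip: m_def)
    ultimately have "n * (Hent q + q * ln a) + k * ln t + m * (Hent \<theta> + \<theta> * ln b - b * Hent (\<theta> / b))
        \<le> ln (matching_sum N (\<lambda>_. t) (\<lambda>_. 1) ts A)"
      by (simp only: ts(2) Diff_cancel sum.empty add_0_right)
    then show ?thesis by (simp add: g_def)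
  qed
  have bound: "real (card (matchings E k)) \<ge> (n choose k) * (exp g * q ^ k * (1 - q) ^ (n - k))"
    unfolding q_def n_def by (subst E, rule matchings_lower_bound) (fact fin k assms(4) lower)+
  define v where "v = real (card A + card B)"
  define p where "p = 2 * real k / v"
  define s where "s = real a + real b"
  have s: "s > 0" using pos by (simp add: s_def)
  \<comment> \<open>The two forms of \<open>v\<close> come from \<open>n * a = m * b\<close>; they
    turn the arguments and prefactors in \<open>Gfun\<close> into \<open>q\<close>,
    \<open>\<theta>\<close>, \<open>n\<close> and \<open>m\<close>.\<close>
  have v: "v = n * s / b"
    using edges' assms(1) by (simp add: v_def s_def n_def[symmetric] m_def[symmetric] field_simps)
  have v': "v = m * s / a"
    using edges' pos by (simp add: v_def s_def n_def[symmetric] m_def[symmetric] field_simps)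
  have vpos: "v > 0" using pos by (simp add: v_def n_def)
  have 1: "s / (2 * real b) * p = q" using s pos assms(1) by (simp add: p_def v q_def)
  have 2: "s / (2 * real a) * p = \<theta>" using s pos by (simp add: p_def v' \<theta>_def)
  have 3: "s / (2 * real a * real b) * p = \<theta> / b" using s pos by (simp add: p_def v' \<theta>_def)
  have 4: "v * (real a / s) = m" using s pos by (simp add: v')
  have 5: "v * (real b / s) = n" using s assms(1) by (simp add: v)
  have 6: "v * (real a * real b / s) = m * b" using s pos by (simp add: v')
  have 7: "v * (1 / 2 * p) = k" using vpos by (simp add: p_def)
  have "v * Gfun a b p = v * (real a / s) * Hent \<theta> + v * (real b / s) * Hent q
      + v * (1 / 2 * p) * ln (real a * real b) - v * (real a * real b / s) * Hent (\<theta> / b)"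
    unfolding Gfun_def s_def[symmetric] 1 2 3 by (simp only: distrib_left right_diff_distrib mult.assoc)
  also have "\<dots> = m * Hent \<theta> + n * Hent q + k * (ln a + ln b) - m * b * Hent (\<theta> / b)"
    unfolding 4 5 6 7 using pos assms(1) by (simp add: ln_mult)
  also have "\<dots> = g"
  proof -
    \<comment> \<open>The term \<open>k * ln (a * b)\<close> splits into the \<open>ln a\<close> of
      the base bound and the \<open>ln b\<close> of the truncations.\<close>
    have "n * q = k" "m * \<theta> = k" using pos by (simp_all add: q_def \<theta>_def)
    then have "k * ln a = n * (q * ln a)" "k * ln b = m * (\<theta> * ln b)"
      by (simp_all flip: mult.assoc)
    then show ?thesis by (simp only: g_def distrib_left right_diff_distrib mult.assoc) simp
  qed
  finally have "v * Gfun a b p = g" .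
  with bound have "real (card A choose k) * q ^ k * (1 - q) ^ (card A - k) * exp (v * Gfun a b p)
      \<le> real (card (matchings E k))"
    by (simp add: n_def mult_ac)
  then show ?thesis
    unfolding Let_def v_def[symmetric] p_def[symmetric] s_def[symmetric] 1 .
qed

end
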